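(* Let $\eta$ be a positive real function on $[2,\infty)$ and let $\mathcal{A}=\{a_n\}_{n\ge1}$ be a strictly increasing sequence of positive integers such that, for some constants $K_1,\dots,K_4>0$ and all $x\ge 2$: $K_1 x/\eta(x)\le\mathcal{A}(x)\le K_2 x/\eta(x)$, $\mathcal{A}(x/2)\ge K_3\mathcal{A}(x)$, and $\mathcal{A}(x,r)\le K_4\frac{r}{\varphi(r)}\frac{x}{\eta(x)^2}$ for every positive integer $r$. Let $f(n)=\gamma_d n^d+\dots+\gamma_0$ be a polynomial with integer coefficients, $\gamma_d>0$, and $f(\mathbb{N})\subseteq\mathbb{N}$. Let $r(n)=\#\{(k,p)\in\mathbb{N}\times\mathbb{P}: a_k+f(p)=n\}$. Then there exist positive constants $x_0,c_1,c_2$ depending only on $f$ and $K_1,\dots,K_4$ such that for all $x\ge x_0$, \[ \#\Big\{n\le x: r(n)\ge c_1\frac{x^{1/d}}{\eta(x)\log x}\Big\}\ge c_2\,x\,\frac{x^{1/d}}{x^{1/d}+\eta(x)\log x}. \]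
   Context: $\mathbb{P}$ is the set of primes. $\mathcal{A}(x)=\#\{n: a_n\le x\}$, $\mathcal{A}(x,r)=\#\{n: a_n\le x,\ a_n+r\in\mathcal{A}\}$; $\varphi$ is Euler's totient function. *)

theory Defs
  imports Complex_Main "HOL-Computational_Algebra.Polynomial" "HOL-Number_Theory.Totient"
begin

text \<open>
  A sequence \<open>(a\<^sub>n)\<close>, \<open>n \<ge> 1\<close>, of positive integers is a function on \<^typ>\<open>nat\<close>; its value at
  index 0 is never used. Throughout, the set of natural numbers starts at 1.
\<close>

definition seq_count :: "(nat \<Rightarrow> nat) \<Rightarrow> real \<Rightarrow> nat" where
  "seq_count a x = card {n. 1 \<le> n \<and> real (a n) \<le> x}"

definition seq_count_shift :: "(nat \<Rightarrow> nat) \<Rightarrow> real \<Rightarrow> nat \<Rightarrow> nat" where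
  "seq_count_shift a x r = card {n. 1 \<le> n \<and> real (a n) \<le> x \<and> a n + r \<in> a ` {1..}}"

definition rep_count :: "(nat \<Rightarrow> nat) \<Rightarrow> int poly \<Rightarrow> nat \<Rightarrow> nat" where
  "rep_count a f n =
     card {(k, p). 1 \<le> k \<and> prime p \<and> int (a k) + poly f (int p) = int n}"

end

theory Submission
  imports Defs "HOL-Analysis.Convex" "HOL-Analysis.Summation_Tests"
begin

text \<open>
  Let \<open>d\<close> be the degree of \<open>f\<close> and choose \<open>Y\<close> of order \<open>x powr (1/d)\<close> with \<open>f(p) \<le> x/2\<close> for primes \<open>p \<le> Y\<close>.
  Count representations \<open>n = a k + f p\<close> with \<open>a k \<le> x/2\<close> and \<open>p \<le> Y\<close>. By Chebyshev there are many of
  them in total, and by Cauchy--Schwarz it suffices to bound the second moment, that is the number of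
  quadruples with \<open>a k + f p = a k' + f q\<close>. For \<open>p \<noteq> q\<close> the hypothesis on shifts reduces this to
  \<open>\<Sum>\<^bsub>p\<^esub> F (f p - f q) = O(Y / ln Y)\<close> uniformly in \<open>q\<close>, where \<open>F n = n / \<phi>(n)\<close>.

  Since \<open>F n \<le> 1 + 4 (\<Sum>\<^bsub>l | n\<^esub> 1 / sqrt l)\<close> over primes \<open>l\<close>, one only needs the number of primes \<open>p \<le> Y\<close> with
  \<open>f p \<equiv> f q\<close> modulo a prime \<open>l \<le> sqrt Y\<close>. There are at most \<open>d\<close> residue classes for \<open>p\<close>, and instead of the
  Brun--Titchmarsh inequality a bound \<open>O((Y / l) (ln l / ln Y))\<close> for each class suffices, because
  \<open>\<Sum> ln l / l powr (3/2)\<close> converges. This weaker bound has a proof in the style of Erdos: the product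
  of \<open>k l + a\<close> for \<open>k < n\<close> times \<open>l ^ n\<close> is divisible by \<open>n!\<close> and by all primes \<open>p \<equiv> a\<close> (mod \<open>l\<close>) with
  \<open>n < p < n l\<close>, so the product of these primes is at most \<open>l ^ (2 n)\<close>. The case \<open>l = 2\<close> gives the upper
  Chebyshev bound.
\<close>

section \<open>Primes in arithmetic progressions\<close>

lemma multiplicity_eq_card:
  fixes q k :: nat
  assumes "prime q" "0 < k" "k \<le> m"
  shows "multiplicity q k = card {i\<in>{1..m}. q ^ i dvd k}"
proof -
  have "multiplicity q k < q ^ multiplicity q k"
    using assms(1) prime_gt_1_nat by (intro power_gt_expt) auto
  also have "\<dots> \<le> k"
    using assms multiplicity_dvd by (intro dvd_imp_le) auto
  finally have "multiplicity q k \<le> m" using assms by linarith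
  moreover have "q ^ i dvd k \<longleftrightarrow> i \<le> multiplicity q k" for i
    using assms prime_gt_1_nat[OF assms(1)] by (intro power_dvd_iff_le_multiplicity) auto
  ultimately have "{i\<in>{1..m}. q ^ i dvd k} = {1..multiplicity q k}"
    by (simp only:) force
  then show ?thesis by simp
qed

lemma card_multiples: "card {k\<in>{1..n}. d dvd k} = n div (d::nat)"
proof (cases "d = 0")
  case False
  have "{k\<in>{1..n}. d dvd k} = (\<lambda>j. d * j) ` {1..n div d}"
    using False by (auto simp: dvd_def less_eq_div_iff_mult_less_eq mult.commute image_iff Suc_le_eq)
  also have "card \<dots> = n div d"
    using False by (subst card_image) (auto simp: inj_on_def)
  finally show ?thesis .
qed auto

text \<open>Legendre's formula, by counting pairs \<open>(k, i)\<close> with \<open>q ^ i\<close>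
  dividing \<open>k\<close> in two ways. The cutoff \<open>m\<close> is free so that the formulas
  for \<open>n\<close> and \<open>2 * n\<close> can be subtracted termwise.\<close>

lemma multiplicity_fact:
  assumes "prime (q::nat)" "n \<le> m"
  shows "multiplicity q (fact n) = (\<Sum>i=1..m. n div q ^ i)"
proof -
  have "multiplicity q (fact n) = (\<Sum>k=1..n. multiplicity q k)"
    using assms by (subst fact_prod, simp, subst prime_elem_multiplicity_prod_distrib) auto
  also have "\<dots> = (\<Sum>k=1..n. \<Sum>i=1..m. if q ^ i dvd k then 1 else 0)"
  proof (intro sum.cong refl)
    fix k assume k: "k \<in> {1..n}"
    have "multiplicity q k = card {i\<in>{1..m}. q ^ i dvd k}"
      using k assms by (intro multiplicity_eq_card) auto
    then show "multiplicity q k = (\<Sum>i=1..m. if q ^ i dvd k then 1 else 0)"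
      by (simp flip: sum.inter_filter)
  qed
  also have "\<dots> = (\<Sum>i=1..m. \<Sum>k=1..n. if q ^ i dvd k then 1 else 0)"
    by (rule sum.swap)
  also have "\<dots> = (\<Sum>i=1..m. card {k\<in>{1..n}. q ^ i dvd k})"
    by (simp flip: sum.inter_filter)
  finally show ?thesis by (simp only: card_multiples)
qed

text \<open>In Legendre's formula \<open>q\<close> may be lowered to 2. This is why the factor
  \<open>l ^ n\<close> suffices for the primes dividing \<open>l\<close>.\<close>

lemma multiplicity_fact_le:
  assumes "prime (q::nat)"
  shows "multiplicity q (fact n) \<le> n"
proof -
  \<comment> \<open>Subtracting \<open>n div 2 ^ m\<close> makes the claim inductive: each halving
    moves at most half of the remainder into the sum.\<close>
  have *: "(\<Sum>i=1..m. n div 2 ^ i) \<le> n - n div 2 ^ m" for m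
  proof (induction m)
    case (Suc m)
    define A where "A = n div 2 ^ m"
    have "n div 2 ^ Suc m = A div 2" by (simp only: power_Suc2 div_mult2_eq A_def)
    moreover have "A \<le> n" by (simp add: A_def)
    ultimately show ?case using Suc by (simp add: A_def [symmetric] del: power_Suc)
  qed auto
  have "multiplicity q (fact n) = (\<Sum>i=1..n. n div q ^ i)"
    using assms by (rule multiplicity_fact) simp
  also have "\<dots> \<le> (\<Sum>i=1..n. n div 2 ^ i)"
    using assms prime_ge_2_nat by (intro sum_mono div_le_mono2 power_mono) auto
  also have "\<dots> \<le> n" using *[of n] by linarith
  finally show ?thesis .
qed

text \<open>
  For a prime \<open>q\<close> not dividing \<open>l\<close>, multiplying by an inverse of \<open>l\<close> modulo \<open>q ^ v\<close> turns the progression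
  into consecutive integers; the primes dividing \<open>l\<close> are taken care of by the factor \<open>l ^ n\<close>.
\<close>

lemma fact_dvd_prod_progression:
  fixes l a n :: nat
  assumes "l > 0"
  shows "fact n dvd l ^ n * (\<Prod>k<n. k * l + a)"
proof (cases "(\<Prod>k<n. k * l + a) = 0")
  case nz: False
  define X where "X = l ^ n * (\<Prod>k<n. k * l + a)"
  have X: "X \<noteq> 0" using nz assms by (simp add: X_def)
  have "fact n dvd X"
  proof (rule multiplicity_le_imp_dvd)
    fix q :: nat assume q: "prime q"
    define v where "v = multiplicity q (fact n :: nat)"
    have "q ^ v dvd X"
    proof (cases "q dvd l")
      case True
      have "q ^ v dvd q ^ n" using multiplicity_fact_le[OF q, of n] by (simp add: v_def le_imp_power_dvd)
      also have "\<dots> dvd l ^ n" using True by (rule dvd_power_same)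
      finally show ?thesis by (simp add: X_def)
    next
      case False
      then have "coprime q l"
        using q by (intro prime_imp_coprime)
      then have "coprime (int l) (int (q ^ v))"
        by (simp add: coprime_commute)
      then obtain b where b: "[int l * b = 1] (mod int (q ^ v))"
        using cong_solve_coprime_int by blast
      have "[b ^ n * (\<Prod>k<n. int k * int l + int a) = (\<Prod>k<n. b * int a + int k)] (mod int (q ^ v))"
      proof -
        have "b ^ n * (\<Prod>k<n. int k * int l + int a) = (\<Prod>k<n. b * (int k * int l + int a))"
          by (simp add: prod.distrib)
        moreover have "[b * (int k * int l + int a) = b * int a + int k] (mod int (q ^ v))" for k
        proof -
          have "[b * int a + int k * (int l * b) = b * int a + int k * 1] (mod int (q ^ v))"
            by (intro cong_add cong_mult b cong_refl)
          then show ?thesis by (simp add: algebra_simps)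
        qed
        ultimately show ?thesis by (simp add: cong_prod)
      qed
      \<comment> \<open>A product of \<open>n\<close> consecutive integers is a multiple of
        \<open>fact n\<close>. The integer Pochhammer symbol is used because \<open>b\<close> may be
        negative.\<close>
      moreover have "int (q ^ v) dvd (\<Prod>k<n. b * int a + int k)"
      proof -
        have "int (q ^ v) dvd int (fact n)"
          unfolding v_def by (subst int_dvd_int_iff) (rule multiplicity_dvd)
        also have "int (fact n) dvd (\<Prod>k<n. b * int a + int k)"
          using fact_dvd_pochhammer[of n "b * int a"] by (simp add: pochhammer_prod lessThan_atLeast0)
        finally show ?thesis .
      qed
      ultimately have "int (q ^ v) dvd b ^ n * (\<Prod>k<n. int k * int l + int a)"
        using cong_dvd_iff by blast
      moreover have "coprime (int (q ^ v)) b"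
        using b by (subst coprime_commute, subst coprime_iff_invertible_int) (auto simp: mult.commute)
      ultimately have "int (q ^ v) dvd (\<Prod>k<n. int k * int l + int a)"
        by (simp add: coprime_dvd_mult_right_iff)
      then have "int (q ^ v) dvd int (\<Prod>k<n. k * l + a)" by simp
      then have "q ^ v dvd (\<Prod>k<n. k * l + a)" by (simp only: int_dvd_int_iff)
      then show ?thesis by (simp add: X_def)
    qed
    then show "multiplicity q (fact n) \<le> multiplicity q X"
      using q X by (intro multiplicity_geI) (auto simp: v_def)
  qed simp
  then show ?thesis by (simp add: X_def)
next
  case True
  then show ?thesis by (simp only:) simp
qed

text \<open>The primes in question exceed \<open>n\<close>, hence are coprime to
  \<open>fact n\<close>, so both divisors of \<open>l ^ n * X\<close> can be multiplied. As
  \<open>a < l\<close>, factorwise comparison gives \<open>X <= l ^ n * fact n\<close>, and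
  \<open>fact n\<close> cancels.\<close>

lemma prod_primes_progression_le:
  fixes n l a :: nat
  assumes "l > 0" "n > 0" "a < l"
  shows "\<Prod>{p. prime p \<and> n < p \<and> p < n * l \<and> p mod l = a} \<le> l ^ (2 * n)"
\<comment> \<open>For \<open>a = 0\<close> the product \<open>X\<close> vanishes and the argument
  breaks down, but then \<open>l\<close> itself is the only possible prime.\<close>
proof (cases "a = 0")
  case True
  have "{p. prime p \<and> n < p \<and> p < n * l \<and> p mod l = a} \<subseteq> {l}"
  proof
    fix p assume "p \<in> {p. prime p \<and> n < p \<and> p < n * l \<and> p mod l = a}"
    then have p: "prime p" "n < p" "p < n * l" "p mod l = a" by auto
    then have "l dvd p" using True by auto
    with p have "l = 1 \<or> l = p" by (simp add: prime_nat_iff)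
    with p show "p \<in> {l}" by auto
  qed
  then consider "{p. prime p \<and> n < p \<and> p < n * l \<and> p mod l = a} = {}"
    | "{p. prime p \<and> n < p \<and> p < n * l \<and> p mod l = a} = {l}" by blast
  then show ?thesis
  proof cases
    case 1
    then show ?thesis using assms by (simp only:) simp
  next
    case 2
    have "l ^ 1 \<le> l ^ (2 * n)" using assms by (intro power_increasing) auto
    then show ?thesis by (simp only: 2) simp
  qed
next
  case False
  define S where "S = {p. prime p \<and> n < p \<and> p < n * l \<and> p mod l = a}"
  define X where "X = (\<Prod>k<n. k * l + a)"
  have fin: "finite S" by (rule finite_subset[of _ "{..<n*l}"]) (auto simp: S_def)
  have "\<Prod>S dvd \<Prod>((\<lambda>k. k * l + a) ` {..<n})"
  proof (rule prod_dvd_prod_subset)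
    show "S \<subseteq> (\<lambda>k. k * l + a) ` {..<n}"
    proof
      fix p assume "p \<in> S"
      then have "p = (p div l) * l + a" "p div l < n"
        using div_mult_mod_eq[of p l] by (auto simp: S_def less_mult_imp_div_less)
      then show "p \<in> (\<lambda>k. k * l + a) ` {..<n}" by blast
    qed
  qed auto
  also have "\<Prod>((\<lambda>k. k * l + a) ` {..<n}) = X"
    unfolding X_def using assms by (subst prod.reindex) (auto simp: inj_on_def)
  finally have "\<Prod>S dvd l ^ n * X" by simp
  moreover have "fact n dvd l ^ n * X"
    unfolding X_def using assms by (intro fact_dvd_prod_progression) auto
  moreover have "coprime (\<Prod>S) (fact n)"
  proof (rule prod_coprime_left)
    fix p assume "p \<in> S"
    then show "coprime p (fact n)"
      by (intro prime_imp_coprime) (auto simp: S_def prime_dvd_fact_iff)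
  qed
  ultimately have "\<Prod>S * fact n dvd l ^ n * X" by (rule divides_mult)
  moreover have "l ^ n * X > 0" using assms False by (auto simp: X_def)
  ultimately have "\<Prod>S * fact n \<le> l ^ n * X" by (rule dvd_imp_le)
  also have "l ^ n * X \<le> l ^ n * (l ^ n * fact n)"
  proof (rule mult_left_mono)
    have "X \<le> (\<Prod>k<n. Suc k * l)"
      unfolding X_def using assms by (intro prod_mono) auto
    also have "\<dots> = l ^ n * fact n"
      by (simp add: prod.distrib fact_prod_Suc lessThan_atLeast0 del: mult_Suc)
    finally show "X \<le> l ^ n * fact n" .
  qed simp
  finally have "\<Prod>S * fact n \<le> l ^ (2 * n) * fact n"
    by (simp only: mult_2 power_add mult.assoc)
  then show ?thesis by (simp add: S_def)
qed

lemma card_primes_progression_le: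
  fixes n l a :: nat
  assumes "l > 0" "n > 0" "a < l"
  shows "real (card {p. prime p \<and> n < p \<and> p < n * l \<and> p mod l = a}) * ln n \<le> 2 * real n * ln l"
proof -
  define S where "S = {p. prime p \<and> n < p \<and> p < n * l \<and> p mod l = a}"
  have "n ^ card S \<le> \<Prod>S"
    using prod_mono[of S "\<lambda>_. n" "\<lambda>x. x"] by (auto simp: S_def)
  also have "\<dots> \<le> l ^ (2 * n)" unfolding S_def using assms by (rule prod_primes_progression_le)
  finally have "real n ^ card S \<le> real l ^ (2 * n)"
    by (simp only: of_nat_power [symmetric] of_nat_le_iff)
  then have "ln (real n ^ card S) \<le> ln (real l ^ (2 * n))"
    using assms by (subst ln_le_cancel_iff) auto
  then show ?thesis using assms by (simp add: ln_realpow S_def)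
qed

section \<open>Chebyshev bounds\<close>

definition primes_le :: "nat \<Rightarrow> nat set" where
  "primes_le m = {p. prime p \<and> p \<le> m}"

lemma finite_primes_le [simp]: "finite (primes_le m)"
  by (rule finite_subset[of _ "{..m}"]) (auto simp: primes_le_def)

text \<open>Strong induction, cutting at \<open>n = m div 2 + 1\<close>: the primes above
  \<open>n\<close> are odd and fall under the progression bound with \<open>l = 2\<close>,
  \<open>a = 1\<close>.\<close>

lemma prod_primes_le: "\<Prod>(primes_le m) \<le> 64 ^ m"
proof (induction m rule: less_induct)
  case (less m)
  consider "m \<le> 1" | "m = 2 \<or> m = 3" | "m \<ge> 4" by linarith
  then show ?case
  proof cases
    case 1
    then have "primes_le m = {}" by (auto simp: primes_le_def dest: prime_ge_2_nat)
    then show ?thesis by simp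
  next
    case 2
    have "\<Prod>(primes_le m) dvd \<Prod>{2, 3::nat}"
    proof (rule prod_dvd_prod_subset)
      show "primes_le m \<subseteq> {2, 3}" using 2 by (auto simp: primes_le_def dest: prime_ge_2_nat)
    qed simp
    then have "\<Prod>(primes_le m) \<le> 6" by (intro dvd_imp_le) auto
    also have "\<dots> \<le> 64 ^ m" using 2 by auto
    finally show ?thesis .
  next
    case 3
    define n where "n = m div 2 + 1"
    define S where "S = {p. prime p \<and> n < p \<and> p < n * 2 \<and> p mod 2 = 1}"
    have finS: "finite S" by (rule finite_subset[of _ "{..<n*2}"]) (auto simp: S_def)
    have "primes_le m \<subseteq> primes_le n \<union> S"
    proof
      fix p assume p: "p \<in> primes_le m"
      have "p mod 2 = 1" if "p > n"
        using p that 3 prime_odd_nat[of p] by (auto simp: primes_le_def n_def odd_iff_mod_2_eq_one)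
      then show "p \<in> primes_le n \<union> S" using p by (auto simp: S_def primes_le_def n_def)
    qed
    moreover have "primes_le n \<inter> S = {}" by (auto simp: S_def primes_le_def)
    moreover have "\<Prod>(primes_le m) \<le> \<Prod>(primes_le n \<union> S)"
      using calculation(1) finS
      by (intro dvd_imp_le prod_dvd_prod_subset prod_pos)
         (auto simp: primes_le_def S_def prime_gt_0_nat)
    ultimately have "\<Prod>(primes_le m) \<le> \<Prod>(primes_le n) * \<Prod>S"
      using finS by (simp add: prod.union_disjoint)
    also have "\<dots> \<le> 64 ^ n * 2 ^ (2 * n)"
      using less.IH[of n] prod_primes_progression_le[of 2 n 1] 3
      by (intro mult_mono) (auto simp: n_def S_def)
    also have "\<dots> = 2 ^ (6 * n) * 2 ^ (2 * n)" by (simp add: power_mult)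
    also have "\<dots> = 2 ^ (8 * n)" by (simp flip: power_add)
    \<comment> \<open>Here \<open>8 * n <= 4 * m + 8 <= 6 * m\<close> needs \<open>m >= 4\<close>;
      this fixes the base \<open>64 = 2 ^ 6\<close> and the separate small cases.\<close>
    also have "\<dots> \<le> 2 ^ (6 * m)" using 3 by (intro power_increasing) (auto simp: n_def)
    also have "\<dots> = 64 ^ m" by (simp add: power_mult)
    finally show ?thesis .
  qed
qed

lemma ln_le_twice_sqrt: 
  assumes "x > 0"
  shows "ln x \<le> 2 * sqrt x"
  using ln_le_minus_one[of "sqrt x"] assms ln_sqrt[of x] by simp

text \<open>There are at most \<open>sqrt m\<close> primes below \<open>sqrt m\<close>, which
  contribute \<open>2 * m\<close>. The others satisfy \<open>m <= p^2\<close>, so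
  \<open>m ^ card S\<close> is at most the square of the product of all primes up to
  \<open>m\<close>, which contributes \<open>12 * m\<close>.\<close>

lemma card_primes_le_upper:
  assumes "m > 0"
  shows "real (card (primes_le m)) * ln m \<le> 14 * m"
proof -
  define S where "S = {p \<in> primes_le m. m \<le> p\<^sup>2}"
  define T where "T = {p \<in> primes_le m. p\<^sup>2 < m}"
  have fin: "finite S" "finite T" by (auto simp: S_def T_def)
  have "primes_le m = S \<union> T" by (auto simp: S_def T_def)
  then have c: "card (primes_le m) \<le> card S + card T" using card_Un_le[of S T] by simp
  have lnm: "ln (real m) \<ge> 0" using assms by simp
  have "T \<subseteq> {1..nat \<lfloor>sqrt m\<rfloor>}"
  proof
    fix p assume "p \<in> T"
    then have "real p ^ 2 \<le> real m" "p \<ge> 1"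
      by (auto simp: T_def primes_le_def prime_ge_Suc_0_nat simp flip: of_nat_power)
    then show "p \<in> {1..nat \<lfloor>sqrt m\<rfloor>}"
      by (auto simp: le_nat_iff le_floor_iff real_le_rsqrt)
  qed
  then have "card T \<le> nat \<lfloor>sqrt m\<rfloor>" using card_mono[of "{1..nat \<lfloor>sqrt m\<rfloor>}" T] by simp
  then have "real (card T) \<le> real (nat \<lfloor>sqrt m\<rfloor>)" by (simp only: of_nat_le_iff)
  also have "\<dots> \<le> sqrt m" by (rule of_nat_floor) simp
  finally have "real (card T) \<le> sqrt m" .
  then have "real (card T) * ln m \<le> sqrt m * (2 * sqrt m)"
    using ln_le_twice_sqrt[of m] assms lnm by (intro mult_mono) auto
  also have "\<dots> = 2 * m" by simp
  finally have 1: "real (card T) * ln m \<le> 2 * m" .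
  have "m ^ card S \<le> (\<Prod>p\<in>S. p\<^sup>2)"
    using prod_mono[of S "\<lambda>_. m" "\<lambda>p. p\<^sup>2"] by (auto simp: S_def)
  also have "\<dots> = (\<Prod>S)\<^sup>2" by (simp add: prod_power_distrib)
  also have "\<dots> \<le> (\<Prod>(primes_le m))\<^sup>2"
  proof (rule power_mono)
    show "\<Prod>S \<le> \<Prod>(primes_le m)"
      by (intro dvd_imp_le prod_dvd_prod_subset prod_pos)
         (auto simp: primes_le_def S_def prime_gt_0_nat)
  qed simp
  also have "\<dots> \<le> (64 ^ m)\<^sup>2" by (intro power_mono prod_primes_le) auto
  also have "(64::nat) ^ m = 2 ^ (6 * m)" by (simp add: power_mult)
  also have "(2 ^ (6 * m))\<^sup>2 = (2::nat) ^ (6 * m * 2)" by (simp only: power_mult)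
  also have "6 * m * 2 = 12 * m" by simp
  finally have "real m ^ card S \<le> 2 ^ (12 * m)"
    by (simp flip: of_nat_le_iff[where ?'a = real])
  then have "ln (real m ^ card S) \<le> ln (2 ^ (12 * m))"
    using assms by (subst ln_le_cancel_iff) auto
  then have "real (card S) * ln m \<le> 12 * m * ln 2"
    using assms by (simp add: ln_realpow)
  also have "\<dots> \<le> real (12 * m) * 1" using ln_le_minus_one[of 2] by (intro mult_left_mono) auto
  finally have 2: "real (card S) * ln m \<le> 12 * m" by simp
  have "real (card (primes_le m)) * ln m \<le> (real (card S) + real (card T)) * ln m"
    using c lnm by (intro mult_right_mono) linarith+
  then show ?thesis using 1 2 by (simp add: algebra_simps)
qed

text \<open>By Legendre's formula the exponent is a sum of terms
  \<open>(2 * n) div q ^ i - 2 * (n div q ^ i)\<close>. Each is at most 1 and vanishes once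
  \<open>q ^ i > 2 * n\<close>, so the exponent is at most the largest \<open>i\<close> with
  \<open>q ^ i <= 2 * n\<close>.\<close>

lemma power_multiplicity_central_binomial_le:
  assumes "prime (q::nat)" "n > 0"
  shows "q ^ multiplicity q ((2 * n) choose n) \<le> 2 * n"
proof -
  define v where "v = multiplicity q ((2 * n) choose n)"
  define I where "I = {i\<in>{1..2 * n}. q ^ i \<le> 2 * n}"
  have q: "q > 1" using assms prime_gt_1_nat by auto
  have "multiplicity q (fact (2 * n)) = multiplicity q (fact n * fact n * ((2 * n) choose n))"
    using binomial_fact_lemma[of n "2 * n"] by simp
  also have "\<dots> = 2 * multiplicity q (fact n) + v"
    using assms by (simp add: prime_elem_multiplicity_mult_distrib v_def)
  finally have "v = multiplicity q (fact (2 * n)) - 2 * multiplicity q (fact n)" by simp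
  also have "\<dots> = (\<Sum>i=1..2 * n. (2 * n) div q ^ i) - (\<Sum>i=1..2 * n. 2 * (n div q ^ i))"
    using assms by (simp add: multiplicity_fact[of q _ "2 * n"] sum_distrib_left)
  also have "\<dots> \<le> (\<Sum>i=1..2 * n. if q ^ i \<le> 2 * n then 1 else 0)"
  proof -
    have "(2 * n) div d \<le> 2 * (n div d) + (if d \<le> 2 * n then 1 else 0)" if "d > 0" for d
    proof (cases "d \<le> 2 * n")
      case True
      have "n < d * (n div d + 1)" using that by (simp add: dividend_less_times_div algebra_simps)
      then have "2 * n < (2 * (n div d) + 2) * d" by (simp add: algebra_simps)
      then have "(2 * n) div d < 2 * (n div d) + 2" using that less_mult_imp_div_less by blast
      with True show ?thesis by simp
    qed auto
    then have "(\<Sum>i=1..2 * n. (2 * n) div q ^ i)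
      \<le> (\<Sum>i=1..2 * n. 2 * (n div q ^ i) + (if q ^ i \<le> 2 * n then 1 else 0))"
      using q by (intro sum_mono) auto
    then show ?thesis by (simp add: sum.distrib)
  qed
  also have "\<dots> = card I" unfolding I_def by (simp flip: sum.inter_filter)
  finally have v: "v \<le> card I" .
  have "q ^ card I \<le> 2 * n"
  proof (cases "I = {}")
    case False
    have "I \<subseteq> {1..Max I}" using False by (auto simp: I_def)
    then have "card I \<le> Max I" using card_mono[of "{1..Max I}" I] by simp
    then have "q ^ card I \<le> q ^ Max I" using q by (intro power_increasing) auto
    also have "\<dots> \<le> 2 * n" using Max_in[of I] False by (auto simp: I_def)
    finally show ?thesis .
  qed (use assms in simp)
  moreover have "q ^ v \<le> q ^ card I" using v q by (intro power_increasing) auto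
  ultimately show ?thesis by (simp add: v_def)
qed

text \<open>The central binomial coefficient is at least \<open>4 ^ n / (2 * n)\<close>, while each
  of its prime powers is at most \<open>m\<close>; so \<open>4 ^ n\<close> is at most
  \<open>m\<close> to the power of one plus the number of primes. The extra one is absorbed by
  doubling, and the 3 comes from \<open>m <= 3 * n\<close>.\<close>

lemma card_primes_le_lower:
  assumes "m \<ge> 2"
  shows "real m * ln 2 / 3 \<le> real (card (primes_le m)) * ln m"
proof -
  define n where "n = m div 2"
  define B where "B = (2 * n) choose n"
  have n: "n > 0" "2 * n \<le> m" "m \<le> 3 * n" using assms by (auto simp: n_def)
  have B: "B > 0" by (simp add: B_def)
  have "B = (\<Prod>p\<in>prime_factors B. p ^ multiplicity p B)"
    using B by (rule prime_factorization_nat)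
  also have "\<dots> \<le> (\<Prod>p\<in>prime_factors B. m)"
  proof (rule prod_mono, safe)
    fix p assume "p \<in> prime_factors B"
    then have "prime p" by auto
    then have "p ^ multiplicity p B \<le> 2 * n"
      unfolding B_def using n(1) by (rule power_multiplicity_central_binomial_le)
    then show "p ^ multiplicity p B \<le> m" using n(2) by linarith
  qed
  also have "\<dots> = m ^ card (prime_factors B)" by simp
  also have "\<dots> \<le> m ^ card (primes_le m)"
  proof (intro power_increasing card_mono)
    show "prime_factors B \<subseteq> primes_le m"
    proof
      fix p assume p: "p \<in> prime_factors B"
      then have "p dvd B" by auto
      also have "B dvd fact (2 * n)" unfolding B_def
        using binomial_fact_lemma[of n "2 * n"] by (metis dvd_triv_right le_add1 mult_2)
      finally have "p \<le> 2 * n" using prime_dvd_fact_iff[of p "2 * n"] in_prime_factors_imp_prime[OF p] by blast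
      then show "p \<in> primes_le m" using p n by (auto simp: primes_le_def)
    qed
  qed (use assms in auto)
  finally have "real B \<le> real m ^ card (primes_le m)" by (simp flip: of_nat_power)
  moreover have "4 ^ n \<le> (2 * real n) * real B"
    using central_binomial_lower_bound[OF n(1)] n by (simp add: B_def field_simps)
  moreover have "(2 * real n) * real B \<le> real m * real B" using n by (intro mult_right_mono) auto
  ultimately have "4 ^ n \<le> real m * real m ^ card (primes_le m)"
    using assms mult_left_mono[of "real B" "real m ^ card (primes_le m)" "real m"] by linarith
  also have "\<dots> = real m ^ Suc (card (primes_le m))" by simp
  finally have "ln (4 ^ n) \<le> ln (real m ^ Suc (card (primes_le m)))"
    using assms by (subst ln_le_cancel_iff) auto
  then have 1: "real n * ln 4 \<le> (1 + real (card (primes_le m))) * ln m"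
    using assms by (simp add: ln_realpow del: power_Suc)
  have "2 \<in> primes_le m" using assms by (auto simp: primes_le_def)
  then have "card (primes_le m) \<ge> 1" by (auto simp: Suc_le_eq card_gt_0_iff)
  then have "(1 + real (card (primes_le m))) * ln m \<le> (2 * real (card (primes_le m))) * ln m"
    using assms by (intro mult_right_mono) auto
  moreover have "ln (4::real) = 2 * ln 2" using ln_realpow[of 2 2] by simp
  ultimately have "real n * ln 2 \<le> real (card (primes_le m)) * ln m" using 1 by simp
  moreover have "real m / 3 * ln 2 \<le> real n * ln 2" using n by (intro mult_right_mono) auto
  moreover have "real m * ln 2 / 3 = real m / 3 * ln 2" by simp
  ultimately show ?thesis by linarith
qed

text \<open>Primes up to \<open>n = Y div l + 1\<close> are bounded by Chebyshev, the rest by the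
  progression bound. The condition on \<open>l\<close> gives \<open>l < n\<close>, so
  \<open>Y < n * n\<close> and \<open>ln Y <= 2 * ln n\<close>. The constant is
  \<open>2 * 2 * 30\<close>, with 30 from \<open>14 <= 28 * ln l\<close> and one 2 from
  \<open>n <= 2 * (Y / l)\<close>.\<close>

lemma card_primes_le_progression:
  fixes l Y a :: nat
  assumes "l \<ge> 2" "l\<^sup>2 \<le> Y" "a < l"
  shows "real (card {p \<in> primes_le Y. p mod l = a}) * ln Y \<le> 120 * (Y / l) * ln l"
proof -
  define n where "n = Y div l + 1"
  define S where "S = {p. prime p \<and> n < p \<and> p < n * l \<and> p mod l = a}"
  define A where "A = {p \<in> primes_le Y. p mod l = a}"
  have finS: "finite S" by (rule finite_subset[of _ "{..<n*l}"]) (auto simp: S_def)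
  have Yn: "Y < n * l" using assms dividend_less_times_div[of l Y] by (simp add: n_def algebra_simps)
  have "l \<le> Y div l" using assms by (simp add: less_eq_div_iff_mult_less_eq power2_eq_square)
  then have ln: "l < n" by (simp add: n_def)
  have "A \<subseteq> primes_le n \<union> S"
    using Yn by (auto simp: A_def S_def primes_le_def)
  then have "card A \<le> card (primes_le n \<union> S)" using finS by (intro card_mono) auto
  also have "\<dots> \<le> card (primes_le n) + card S" by (rule card_Un_le)
  finally have cA: "real (card A) \<le> real (card (primes_le n)) + real (card S)" by linarith
  have l2: "ln 2 \<le> ln (real l)" using assms by (subst ln_le_cancel_iff) auto
  have half: "1 / 2 \<le> ln (2::real)"
    using ln_le_minus_one[of "1 / 2"] by (simp add: ln_div)
  have "real (card A) * ln n \<le> (real (card (primes_le n)) + real (card S)) * ln n"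
    using cA by (intro mult_right_mono) (auto simp: n_def)
  also have "\<dots> \<le> 14 * n + 2 * n * ln l"
    using card_primes_le_upper[of n] card_primes_progression_le[of l n a] assms
    by (simp add: n_def S_def distrib_right)
  also have "\<dots> \<le> 30 * n * ln l"
    using mult_left_mono[of "1/2" "ln l" "28 * real n"] l2 half by simp
  finally have 1: "real (card A) * ln n \<le> 30 * n * ln l" .
  have "real n \<le> 2 * (Y / l)"
  proof -
    have "n * l \<le> 2 * Y"
    proof -
      have "(Y div l) * l \<le> Y" by (rule div_times_less_eq_dividend)
      moreover have "l \<le> Y" using order_trans[OF le_square[of l]] assms by (simp add: power2_eq_square)
      ultimately show ?thesis by (simp add: n_def add_mult_distrib del: div_times_less_eq_dividend times_div_less_eq_dividend)
    qed
    then have "real (n * l) \<le> real (2 * Y)" by (simp only: of_nat_le_iff)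
    then show ?thesis using assms by (simp add: field_simps)
  qed
  then have "30 * n * ln l \<le> 30 * (2 * (Y / l)) * ln l"
    using assms by (intro mult_right_mono mult_left_mono) auto
  with 1 have 2: "real (card A) * ln n \<le> 60 * (Y / l) * ln l" by simp
  have "ln (real Y) \<le> ln (real (n * n))"
  proof (subst ln_le_cancel_iff)
    have "Y \<le> n * n" using Yn mult_le_mono2[of l n n] ln by linarith
    then show "real Y \<le> real (n * n)" by (simp only: of_nat_le_iff)
    show "real Y > 0" using assms by (auto intro!: Nat.gr0I)
    show "real (n * n) > 0" using ln by simp
  qed
  also have "\<dots> = 2 * ln n" using ln by (simp add: ln_mult)
  finally have "real (card A) * ln Y \<le> real (card A) * (2 * ln n)" by (intro mult_left_mono) auto
  then show ?thesis using 2 by (simp add: A_def)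
qed

section \<open>Averages of the totient ratio over polynomial values at primes\<close>

text \<open>The step from \<open>j\<close> to \<open>j + 1\<close> can only add the prime
  \<open>q = 2 * j + 3\<close>, and its factor is at least 1, so it is included in any case. The
  factor is \<open>(2 * j + 3) / (2 * j + 2)\<close>, at most the quotient of the two square
  roots.\<close>

lemma prod_primes_le_ratio: "(\<Prod>p\<in>primes_le (2 * j + 2). 1 / (1 - 1 / real p)) \<le> 2 * sqrt (2 * j + 1)"
proof (induction j)
  case 0
  have "primes_le 2 = {2}" by (auto simp: primes_le_def dest: prime_ge_2_nat)
  then show ?case by (simp add: numeral_2_eq_2)
next
  case (Suc j)
  define q where "q = 2 * j + 3"
  define g where "g = (\<lambda>p::nat. 1 / (1 - 1 / real p))"
  have sub: "primes_le (2 * Suc j + 2) \<subseteq> insert q (primes_le (2 * j + 2))"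
  proof
    fix p assume p: "p \<in> primes_le (2 * Suc j + 2)"
    moreover have "p \<noteq> 2 * j + 4" using p prime_odd_nat[of "2 * j + 4"] by (auto simp: primes_le_def)
    ultimately show "p \<in> insert q (primes_le (2 * j + 2))" by (auto simp: primes_le_def q_def)
  qed
  have g1: "g p \<ge> 1" if "p \<ge> 2" for p using that by (simp add: g_def field_simps)
  have "prod g (primes_le (2 * Suc j + 2)) \<le> prod g (insert q (primes_le (2 * j + 2)))"
  proof (rule prod_mono2)
    fix p assume "p \<in> insert q (primes_le (2 * j + 2)) - primes_le (2 * Suc j + 2)"
    then show "1 \<le> g p" by (intro g1) (auto simp: primes_le_def q_def dest: prime_ge_2_nat)
  next
    fix p assume "p \<in> primes_le (2 * Suc j + 2)"
    then show "0 \<le> g p" using g1[of p] by (auto simp: primes_le_def dest!: prime_ge_2_nat)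
  qed (use sub in auto)
  also have "\<dots> = g q * prod g (primes_le (2 * j + 2))"
    by (subst prod.insert) (auto simp: primes_le_def q_def)
  also have "\<dots> \<le> g q * (2 * sqrt (2 * j + 1))"
    using Suc g1[of q] by (intro mult_left_mono) (auto simp: g_def q_def)
  also have "g q * (2 * sqrt (2 * j + 1)) = 2 * ((2 * j + 3) / (2 * j + 2) * sqrt (2 * j + 1))"
    by (simp add: g_def q_def field_simps)
  also have "\<dots> \<le> 2 * sqrt (2 * j + 3)"
  proof -
    have "(2 * real j + 3) / (2 * j + 2) * sqrt (2 * j + 1) \<le> sqrt (2 * j + 3)"
    proof (rule real_le_rsqrt)
      have "(2 * real j + 3)\<^sup>2 * (2 * j + 1) \<le> (2 * j + 3) * (2 * real j + 2)\<^sup>2"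
        by (simp add: power2_eq_square algebra_simps)
      then show "((2 * real j + 3) / (2 * j + 2) * sqrt (2 * j + 1))\<^sup>2 \<le> real (2 * j + 3)"
        by (simp add: power_mult_distrib power_divide divide_simps add.commute)
    qed
    then show ?thesis by simp
  qed
  finally show ?case by (simp add: g_def algebra_simps)
qed

text \<open>
  Ordering the primes of \<open>A\<close> increasingly telescopes the product; the partial product below a prime \<open>b\<close>
  is at most a product over odd numbers, hence \<open>O(sqrt b)\<close>.
\<close>

lemma prod_primes_ratio_le:
  assumes "finite A" "\<And>p. p \<in> A \<Longrightarrow> prime (p::nat)"
  shows "(\<Prod>p\<in>A. 1 / (1 - 1 / real p)) \<le> 1 + 4 * (\<Sum>p\<in>A. real p powr (-1/2))"
  using assms
proof (induction A rule: finite_linorder_max_induct)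
  case (insert b A)
  define g where "g = (\<lambda>p::nat. 1 / (1 - 1 / real p))"
  \<comment> \<open>This choice gives \<open>2 * j + 1 <= b <= 2 * j + 2\<close>, so the preceding
    product covers all primes below \<open>b\<close> and its bound is at most
    \<open>2 * sqrt b\<close>.\<close>
  define j where "j = (b - 1) div 2"
  have b: "b \<ge> 2" "prime b" using insert.prems prime_ge_2_nat by auto
  have g1: "g p \<ge> 1" if "p \<ge> 2" for p using that by (simp add: g_def field_simps)
  have "prod g A \<le> prod g (primes_le (2 * j + 2))"
  proof (rule prod_mono2)
    show "A \<subseteq> primes_le (2 * j + 2)"
      using insert.prems insert.hyps by (force simp: primes_le_def j_def)
    fix p assume "p \<in> A"
    then show "0 \<le> g p" using g1[of p] insert.prems prime_ge_2_nat[of p] by auto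
  qed (auto intro!: g1 simp: primes_le_def dest: prime_ge_2_nat)
  also have "\<dots> \<le> 2 * sqrt (2 * j + 1)" unfolding g_def by (rule prod_primes_le_ratio)
  also have "\<dots> \<le> 2 * sqrt b" using b by (auto simp: j_def)
  finally have A: "prod g A \<le> 2 * sqrt b" .
  have gb: "g b = 1 + 1 / (real b - 1)" using b by (simp add: g_def field_simps)
  have "1 / (real b - 1) * prod g A \<le> 2 / real b * (2 * sqrt b)"
  proof (rule mult_mono)
    show "1 / (real b - 1) \<le> 2 / real b" using b by (simp add: field_simps)
    show "0 \<le> prod g A" using insert.prems g1 prime_ge_2_nat
      by (intro prod_nonneg) (meson insertI2 order_trans zero_le_one)
  qed (use A in auto)
  also have "\<dots> = 4 * real b powr (-1/2)"
    using b by (simp add: powr_minus powr_half_sqrt field_simps real_div_sqrt flip: real_sqrt_mult)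
  finally have "prod g (insert b A) \<le> prod g A + 4 * real b powr (-1/2)"
    using insert.hyps by (subst prod.insert) (auto simp: gb algebra_simps)
  moreover have "prod g A \<le> 1 + 4 * (\<Sum>p\<in>A. real p powr (-1/2))"
    unfolding g_def using insert by auto
  ultimately show ?case using insert.hyps by (subst sum.insert) (auto simp: g_def)
qed simp

lemma totient_ratio_le:
  assumes "n > 0"
  shows "real n / real (totient n) \<le> 1 + 4 * (\<Sum>p\<in>prime_factors n. real p powr (-1/2))"
proof -
  have "real n / real (totient n) = (\<Prod>p\<in>prime_factors n. 1 / (1 - 1 / real p))"
    using assms by (simp add: totient_formula2 prod_dividef)
  then show ?thesis using prod_primes_ratio_le[of "prime_factors n"] by auto
qed

text \<open>Lagrange's theorem over the field of residues modulo \<open>l\<close>: synthetic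
  division splits off a root and keeps the leading coefficient, so the hypothesis survives the
  induction on the degree.\<close>

lemma card_roots_mod_prime_le:
  fixes f :: "int poly"
  assumes "prime l" "\<not> int l dvd lead_coeff f"
  shows "card {a\<in>{..<l}. int l dvd poly f (int a)} \<le> degree f"
  using assms(2)
proof (induction "degree f" arbitrary: f)
  case 0
  then obtain c where "f = [:c:]" using degree_eq_zeroE by metis
  then show ?case using 0 by simp
next
  case (Suc n)
  define R where "R = (\<lambda>f. {a\<in>{..<l}. int l dvd poly f (int a)})"
  have fin: "finite (R g)" for g by (simp add: R_def)
  show ?case
  proof (cases "R f = {}")
    case False
    then obtain a where a: "a < l" "int l dvd poly f (int a)" by (auto simp: R_def)
    define h where "h = synthetic_div f (int a)"
    have dh: "degree h = n" using Suc.hyps(2) by (simp add: h_def degree_synthetic_div)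
    have "coeff (f + smult (int a) h) (Suc n) = coeff (pCons (poly f (int a)) h) (Suc n)"
      unfolding h_def by (subst synthetic_div_correct) simp
    then have "lead_coeff h = lead_coeff f"
      using dh by (simp add: coeff_eq_0 flip: Suc.hyps(2))
    with Suc.hyps(1)[of h] Suc.prems dh have cRh: "card (R h) \<le> n" by (simp add: R_def)
    have "R f \<subseteq> insert a (R h)"
    proof
      fix b assume b: "b \<in> R f"
      have "poly f (int b) = (int b - int a) * poly h (int b) + poly f (int a)"
        unfolding h_def by (subst synthetic_div_correct'[of "int a" f, symmetric]) (simp add: algebra_simps)
      then have "int l dvd (int b - int a) * poly h (int b)"
        using b a by (simp add: R_def dvd_add_left_iff)
      then consider "int l dvd int b - int a" | "int l dvd poly h (int b)"
        using assms(1) prime_dvd_mult_iff[of "int l"] by auto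
      then show "b \<in> insert a (R h)"
      proof cases
        case 1
        then have "int b mod int l = int a mod int l" by (simp only: mod_eq_dvd_iff)
        then have "b mod l = a mod l" by (simp only: zmod_int [symmetric] of_nat_eq_iff)
        then show ?thesis using b a by (simp add: R_def)
      qed (use b in \<open>simp add: R_def\<close>)
    qed
    then have "card (R f) \<le> card (insert a (R h))" using fin by (intro card_mono) auto
    also have "\<dots> \<le> Suc (card (R h))" using fin by (simp add: card_insert_if)
    finally show ?thesis using cRh Suc.hyps(2) by (simp add: R_def)
  next
    case True
    then have "card (R f) \<le> degree f" by simp
    then show ?thesis by (simp add: R_def)
  qed
qed

section \<open>Sums over prime divisors of shifted polynomial values\<close>

lemma ln_le_powr_quarter:
  assumes "(x::real) > 0"
  shows "ln x \<le> 4 * x powr (1/4)"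
proof -
  have "ln (x powr (1/4)) \<le> x powr (1/4) - 1" using assms by (intro ln_le_minus_one) simp
  moreover have "ln (x powr (1/4)) = 1/4 * ln x" by (simp add: ln_powr)
  ultimately show ?thesis by simp
qed

lemma sum_Un_le:
  fixes w :: "'a \<Rightarrow> real"
  assumes "finite A" "finite B" "\<And>x. w x \<ge> 0"
  shows "sum w (A \<union> B) \<le> sum w A + sum w B"
proof -
  have "sum w (A \<inter> B) \<ge> 0" by (intro sum_nonneg assms)
  then show ?thesis using sum.union_inter[OF assms(1,2), of w] by linarith
qed

text \<open>Makes the number of prime factors logarithmic in \<open>n\<close>, which controls the
  prime factors above \<open>sqrt Y\<close>.\<close>

lemma card_prime_factors_le:
  assumes "n > 0"
  shows "2 ^ card (prime_factors n) \<le> (n::nat)"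
proof -
  have "2 ^ card (prime_factors n) = (\<Prod>p\<in>prime_factors n. 2::nat)" by simp
  also have "\<dots> \<le> (\<Prod>p\<in>prime_factors n. p ^ multiplicity p n)"
  proof (rule prod_mono)
    fix p assume p: "p \<in> prime_factors n"
    then have "p ^ 1 \<le> p ^ multiplicity p n"
      by (intro power_increasing) (auto simp: prime_factors_multiplicity prime_gt_0_nat Suc_le_eq)
    moreover have "p \<ge> 2" using p prime_ge_2_nat[of p] by auto
    ultimately show "0 \<le> (2::nat) \<and> 2 \<le> p ^ multiplicity p n" by simp
  qed
  also have "\<dots> = n" using prime_factorization_nat[OF assms] by simp
  finally show ?thesis .
qed

text \<open>Subtracting \<open>c\<close> changes only the constant coefficient, so
  \<open>p mod l\<close> is one of at most \<open>degree f\<close> roots; each of these classes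
  obeys the progression bound. The result is uniform in \<open>c\<close>.\<close>

lemma card_primes_poly_cong_le:
  fixes f :: "int poly" and c :: int and l Y :: nat
  assumes "degree f \<ge> 1" "prime l" "\<not> int l dvd lead_coeff f" "l\<^sup>2 \<le> Y"
  shows "real (card {p\<in>primes_le Y. int l dvd poly f (int p) - c}) * ln Y
    \<le> degree f * (120 * (Y / l) * ln l)"
proof -
  define g where "g = f - [:c:]"
  define R where "R = {a\<in>{..<l}. int l dvd poly g (int a)}"
  define A where "A = (\<lambda>a. {p\<in>primes_le Y. p mod l = a})"
  have l: "l \<ge> 2" using assms prime_ge_2_nat by auto
  have dg: "degree g = degree f" "lead_coeff g = lead_coeff f"
  proof -
    show "degree g = degree f"
      using assms(1) degree_add_eq_left[of "-[:c:]" f] by (simp add: g_def del: minus_pCons)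
    then show "lead_coeff g = lead_coeff f" using assms(1)
      by (simp add: g_def coeff_pCons split: nat.split)
  qed
  have cR: "card R \<le> degree f"
    using card_roots_mod_prime_le[of l g] assms dg by (simp add: R_def)
  have "{p\<in>primes_le Y. int l dvd poly f (int p) - c} \<subseteq> (\<Union>a\<in>R. A a)"
  proof
    fix p assume p: "p \<in> {p\<in>primes_le Y. int l dvd poly f (int p) - c}"
    have "[int (p mod l) = int p] (mod int l)" by (simp add: zmod_int cong_def)
    then have "[poly g (int (p mod l)) = poly g (int p)] (mod int l)"
      by (induction g) (auto intro: cong_add cong_mult)
    then have "int l dvd poly g (int (p mod l))" using p by (simp add: cong_dvd_iff g_def)
    then have "p mod l \<in> R" using l by (simp add: R_def)
    then show "p \<in> (\<Union>a\<in>R. A a)" using p by (auto simp: A_def)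
  qed
  then have "card {p\<in>primes_le Y. int l dvd poly f (int p) - c} \<le> card (\<Union>a\<in>R. A a)"
    by (intro card_mono) (auto simp: R_def A_def)
  also have "\<dots> \<le> (\<Sum>a\<in>R. card (A a))"
    by (rule card_UN_le) (auto simp: R_def)
  finally have "real (card {p\<in>primes_le Y. int l dvd poly f (int p) - c}) \<le> (\<Sum>a\<in>R. real (card (A a)))"
    by (simp flip: of_nat_sum)
  moreover have lnY: "ln (real Y) \<ge> 0" by (cases "Y = 0") auto
  ultimately have "real (card {p\<in>primes_le Y. int l dvd poly f (int p) - c}) * ln Y
      \<le> (\<Sum>a\<in>R. real (card (A a))) * ln Y"
    by (intro mult_right_mono)
  also have "\<dots> = (\<Sum>a\<in>R. real (card (A a)) * ln Y)" by (simp add: sum_distrib_right)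
  also have "\<dots> \<le> (\<Sum>a\<in>R. 120 * (Y / l) * ln l)"
    unfolding A_def using assms l by (intro sum_mono card_primes_le_progression) (auto simp: R_def)
  also have "\<dots> = card R * (120 * (Y / l) * ln l)" by simp
  also have "\<dots> \<le> degree f * (120 * (Y / l) * ln l)"
    using cR l by (intro mult_right_mono) auto
  finally show ?thesis .
qed

text \<open>The totient ratio is replaced by a sum over prime divisors \<open>l\<close>, split at
  \<open>M\<close> and at \<open>sqrt Y\<close>. The outer ranges are bounded for each
  \<open>p\<close> separately; in the middle range the sums over \<open>p\<close> and
  \<open>l\<close> are interchanged. \<open>C\<close> must not depend on \<open>c\<close>, which
  later runs through the values \<open>f q\<close>.\<close>

lemma sum_totient_ratio_poly_le:
  fixes f :: "int poly" and B :: real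
  assumes f: "degree f \<ge> 1" "lead_coeff f > 0" and B: "B \<ge> 1"
  shows "\<exists>C>0. \<forall>Y\<ge>2. \<forall>c S. S \<subseteq> primes_le Y \<longrightarrow>
    (\<forall>p\<in>S. 1 \<le> poly f (int p) - c \<and> real_of_int (poly f (int p) - c) \<le> B * real Y ^ degree f) \<longrightarrow>
    (\<Sum>p\<in>S. real (nat (poly f (int p) - c)) / real (totient (nat (poly f (int p) - c)))) * ln Y \<le> C * Y"
proof -
  define d where "d = degree f"
  \<comment> \<open>A prime \<open>l > M\<close> cannot divide the leading coefficient, so the root
    count modulo \<open>l\<close> applies.\<close>
  define M where "M = nat (lead_coeff f)"
  \<comment> \<open>Bounds the weights of the prime factors above \<open>sqrt Y\<close>: at most
    \<open>2 * (B + 4 * d * Y powr (1/4))\<close> of them, each of weight at most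
    \<open>Y powr (-1/4)\<close>.\<close>
  define W where "W = 2 * (B + 4 * real d)"
  \<comment> \<open>The exponent is \<open>-1/2 - 1 + 1/4\<close>: the weight of \<open>l\<close>,
    the density \<open>1 / l\<close> of a class, and
    \<open>ln l <= 4 * l powr (1/4)\<close>.\<close>
  define Z where "Z = (\<Sum>n. real n powr (-5/4))"
  have sZ: "summable (\<lambda>n. real n powr (-5/4))" by (subst summable_real_powr_iff) simp
  have Z: "(\<Sum>l\<in>L. real l powr (-5/4)) \<le> Z" if "finite L" for L
    unfolding Z_def using that by (intro sum_le_suminf sZ) auto
  have Z0: "Z \<ge> 0" using Z[of "{}"] by simp
  define C where "C = 14 * (1 + 4 * (M + W)) + 4 * (480 * real d * Z)"
  have "C > 0"
    using B Z0 by (auto simp: C_def W_def intro!: add_pos_nonneg mult_nonneg_nonneg)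
  have bound: "(\<Sum>p\<in>S. real (nat (poly f (int p) - c)) / real (totient (nat (poly f (int p) - c)))) * ln Y \<le> C * Y"
    if Y: "Y \<ge> 2" and S: "S \<subseteq> primes_le Y"
      and fS': "\<forall>p\<in>S. 1 \<le> poly f (int p) - c \<and> real_of_int (poly f (int p) - c) \<le> B * real Y ^ degree f"
    for Y c S
  proof -
    have fS: "1 \<le> poly f (int p) - c \<and> real_of_int (poly f (int p) - c) \<le> B * real Y ^ degree f"
      if "p \<in> S" for p using fS' that by simp
    define r where "r = (\<lambda>p. nat (poly f (int p) - c))"
    define L where "L = {l\<in>primes_le Y. M < l \<and> l\<^sup>2 \<le> Y}"
    define w where "w = (\<lambda>l::nat. real l powr (-1/2))"
    have w1: "w l \<le> 1" for l
      by (cases "l = 0") (auto simp: w_def powr_le_one_le ge_one_powr_ge_zero powr_minus_divide)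
    have w0: "w l \<ge> 0" for l by (simp add: w_def)
    have finS: "finite S" using S by (rule finite_subset) simp
    have lnY: "ln (real Y) > 0" using Y by simp
    have point: "real (r p) / real (totient (r p)) \<le> (1 + 4 * (M + W)) + 4 * (\<Sum>l\<in>L. if l dvd r p then w l else 0)"
      if p: "p \<in> S" for p
    proof -
      define n where "n = r p"
      have n: "n > 0" "real n \<le> B * real Y ^ d" using fS[OF p] by (auto simp: n_def r_def d_def)
      define P where "P = prime_factors n"
      have "P \<subseteq> {1..M} \<union> ({l\<in>L. l dvd n} \<union> {l\<in>P. Y < l\<^sup>2})"
      proof
        fix l assume l: "l \<in> P"
        then have "prime l" "l dvd n" by (auto simp: P_def)
        moreover have "l \<le> l\<^sup>2" by (simp add: power2_nat_le_eq_le le_square power2_eq_square)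
        ultimately show "l \<in> {1..M} \<union> ({l\<in>L. l dvd n} \<union> {l\<in>P. Y < l\<^sup>2})"
          using l by (auto simp: L_def primes_le_def prime_ge_Suc_0_nat)
      qed
      then have "sum w P \<le> sum w ({1..M} \<union> ({l\<in>L. l dvd n} \<union> {l\<in>P. Y < l\<^sup>2}))"
        by (intro sum_mono2) (auto simp: w_def L_def P_def)
      also have "\<dots> \<le> sum w {1..M} + sum w ({l\<in>L. l dvd n} \<union> {l\<in>P. Y < l\<^sup>2})"
        by (intro sum_Un_le) (auto simp: w_def L_def P_def)
      also have "sum w ({l\<in>L. l dvd n} \<union> {l\<in>P. Y < l\<^sup>2}) \<le> sum w {l\<in>L. l dvd n} + sum w {l\<in>P. Y < l\<^sup>2}"
        by (intro sum_Un_le) (auto simp: w_def L_def P_def)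
      also have "sum w {1..M} \<le> (\<Sum>l\<in>{1..M}. 1)" using w1 by (intro sum_mono) auto
      also have "sum w {l\<in>P. Y < l\<^sup>2} \<le> W"
      proof -
        have "sum w {l\<in>P. Y < l\<^sup>2} \<le> (\<Sum>l\<in>{l\<in>P. Y < l\<^sup>2}. real Y powr (-1/4))"
        proof (rule sum_mono)
          fix l assume l: "l \<in> {l\<in>P. Y < l\<^sup>2}"
          then have "l > 0" using prime_gt_0_nat[of l] by (auto simp: P_def)
          have "w l = (real l ^ 2) powr (-1/4)"
            using \<open>l > 0\<close> by (simp add: w_def powr_powr flip: powr_numeral)
          also have "\<dots> \<le> real Y powr (-1/4)"
            using l Y by (intro powr_mono2') (auto simp flip: of_nat_power)
          finally show "w l \<le> real Y powr (-1/4)" .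
        qed
        also have "\<dots> = real (card {l\<in>P. Y < l\<^sup>2}) * real Y powr (-1/4)" by simp
        also have "\<dots> \<le> real (card P) * real Y powr (-1/4)"
          by (intro mult_right_mono) (auto intro!: card_mono simp: P_def)
        also have "\<dots> \<le> (2 * (B + d * (4 * real Y powr (1/4)))) * real Y powr (-1/4)"
        proof (rule mult_right_mono)
          have "real (2 ^ card P) \<le> real n"
            using card_prime_factors_le[OF n(1)] by (simp only: P_def of_nat_le_iff)
          also note n(2)
          finally have "ln (2 ^ card P) \<le> ln (B * real Y ^ d)"
            using B Y by (subst ln_le_cancel_iff) auto
          then have "real (card P) * ln 2 \<le> ln B + d * ln Y"
            using B Y by (simp add: ln_realpow ln_mult)
          also have "\<dots> \<le> B + d * (4 * real Y powr (1/4))"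
            using B Y ln_le_minus_one[of B] by (intro add_mono mult_left_mono ln_le_powr_quarter) auto
          finally have "real (card P) * ln 2 \<le> B + d * (4 * real Y powr (1/4))" .
          moreover have "real (card P) * (1/2) \<le> real (card P) * ln 2"
            using ln_le_minus_one[of "1/2"] by (intro mult_left_mono) (auto simp: ln_div)
          ultimately show "real (card P) \<le> 2 * (B + d * (4 * real Y powr (1/4)))" by simp
        qed simp
        also have "\<dots> = 2 * B * real Y powr (-1/4) + 8 * d * (real Y powr (1/4) * real Y powr (-1/4))"
          by (simp add: algebra_simps)
        also have "real Y powr (1/4) * real Y powr (-1/4) = 1"
          using Y by (simp flip: powr_add)
        also have "2 * B * real Y powr (-1/4) \<le> 2 * B * 1"
          using B Y by (intro mult_left_mono) (auto simp: powr_le_one_le ge_one_powr_ge_zero powr_minus_divide)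
        finally show ?thesis by (simp add: W_def)
      qed
      finally have "sum w P \<le> M + (sum w {l\<in>L. l dvd n} + W)" by simp
      moreover have "sum w {l\<in>L. l dvd n} = (\<Sum>l\<in>L. if l dvd n then w l else 0)"
        by (rule sum.inter_filter) (simp add: L_def)
      moreover have "real n / real (totient n) \<le> 1 + 4 * sum w P"
        using totient_ratio_le[OF n(1)] by (simp add: w_def P_def)
      ultimately show ?thesis by (simp add: n_def)
    qed
    have N: "w l * real (card {p\<in>S. l dvd r p}) * ln Y \<le> (480 * real d * Y) * real l powr (-5/4)"
      if l: "l \<in> L" for l
    proof -
      have pl: "prime l" "M < l" "l\<^sup>2 \<le> Y" using l by (auto simp: L_def primes_le_def)
      then have l0: "real l > 0" using prime_gt_0_nat by auto
      have nd: "\<not> int l dvd lead_coeff f"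
      proof
        assume "int l dvd lead_coeff f"
        then have "int l \<le> lead_coeff f" using f by (intro zdvd_imp_le)
        then show False using pl f by (simp add: M_def)
      qed
      have "{p\<in>S. l dvd r p} \<subseteq> {p\<in>primes_le Y. int l dvd poly f (int p) - c}"
      proof
        fix p assume p: "p \<in> {p\<in>S. l dvd r p}"
        then have "int l dvd int (r p)" by simp
        moreover have "int (r p) = poly f (int p) - c" using fS[of p] p by (simp add: r_def)
        ultimately show "p \<in> {p\<in>primes_le Y. int l dvd poly f (int p) - c}" using p S by auto
      qed
      then have "real (card {p\<in>S. l dvd r p}) * ln Y
          \<le> real (card {p\<in>primes_le Y. int l dvd poly f (int p) - c}) * ln Y"
        using lnY by (intro mult_right_mono) (auto intro!: card_mono)
      also have "\<dots> \<le> d * (120 * (Y / l) * ln l)"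
        unfolding d_def by (rule card_primes_poly_cong_le) (use f pl nd in auto)
      also have "\<dots> \<le> d * (120 * (Y / l) * (4 * real l powr (1/4)))"
        using l0 by (intro mult_left_mono ln_le_powr_quarter) auto
      also have "\<dots> = (480 * real d * Y) * (real l powr (1/4) * real l powr (-1))"
        using l0 by (simp add: powr_minus field_simps)
      also have "real l powr (1/4) * real l powr (-1) = real l powr (-3/4)"
        by (simp only: powr_add [symmetric]) simp
      finally have "w l * (real (card {p\<in>S. l dvd r p}) * ln Y)
          \<le> w l * ((480 * real d * Y) * real l powr (-3/4))"
        by (intro mult_left_mono w0)
      also have "\<dots> = (480 * real d * Y) * (w l * real l powr (-3/4))" by simp
      also have "w l * real l powr (-3/4) = real l powr (-5/4)"
        by (simp add: w_def flip: powr_add)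
      finally show ?thesis by (simp add: mult.assoc)
    qed
    have "(\<Sum>p\<in>S. real (r p) / real (totient (r p)))
      \<le> (\<Sum>p\<in>S. (1 + 4 * (M + W)) + 4 * (\<Sum>l\<in>L. if l dvd r p then w l else 0))"
      by (intro sum_mono point)
    also have "\<dots> = real (card S) * (1 + 4 * (M + W)) + 4 * (\<Sum>p\<in>S. \<Sum>l\<in>L. if l dvd r p then w l else 0)"
      by (simp add: sum.distrib sum_distrib_left)
    also have "(\<Sum>p\<in>S. \<Sum>l\<in>L. if l dvd r p then w l else 0) = (\<Sum>l\<in>L. \<Sum>p\<in>S. if l dvd r p then w l else 0)"
      by (rule sum.swap)
    also have "\<dots> = (\<Sum>l\<in>L. w l * real (card {p\<in>S. l dvd r p}))"
      using finS by (simp add: mult.commute flip: sum.inter_filter)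
    finally have "(\<Sum>p\<in>S. real (r p) / real (totient (r p))) * ln Y
        \<le> (real (card S) * (1 + 4 * (M + W)) + 4 * (\<Sum>l\<in>L. w l * real (card {p\<in>S. l dvd r p}))) * ln Y"
      using lnY by (intro mult_right_mono) auto
    also have "\<dots> = (real (card S) * ln Y) * (1 + 4 * (M + W)) + 4 * (\<Sum>l\<in>L. w l * real (card {p\<in>S. l dvd r p}) * ln Y)"
      by (simp only: sum_distrib_right [symmetric]) (simp add: algebra_simps)
    also have "\<dots> \<le> (14 * Y) * (1 + 4 * (M + W)) + 4 * ((480 * real d * Y) * Z)"
    proof (intro add_mono mult_left_mono mult_right_mono)
      have "real (card S) * ln Y \<le> real (card (primes_le Y)) * ln Y"
        using S lnY by (intro mult_right_mono) (auto intro!: card_mono)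
      also have "\<dots> \<le> 14 * Y" using card_primes_le_upper[of Y] Y by simp
      finally show "real (card S) * ln Y \<le> 14 * Y" .
      have "(\<Sum>l\<in>L. w l * real (card {p\<in>S. l dvd r p}) * ln Y) \<le> (\<Sum>l\<in>L. (480 * real d * Y) * real l powr (-5/4))"
        by (intro sum_mono N)
      also have "\<dots> \<le> (480 * real d * Y) * Z"
        unfolding sum_distrib_left[symmetric] by (intro mult_left_mono Z) (auto simp: L_def)
      finally show "(\<Sum>l\<in>L. w l * real (card {p\<in>S. l dvd r p}) * ln Y) \<le> (480 * real d * Y) * Z" .
      show "0 \<le> 1 + 4 * (real M + W)" using B by (simp add: W_def)
    qed simp
    also have "\<dots> = C * Y" by (simp add: C_def algebra_simps)
    finally show ?thesis by (simp add: r_def)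
  qed
  show ?thesis
    by (rule exI[of _ C], intro conjI allI impI bound) (fact \<open>C > 0\<close>)
qed

section \<open>Moments of the number of representations\<close>

lemma finite_seq_le:
  assumes "strict_mono_on {1..} (a :: nat \<Rightarrow> nat)"
  shows "finite {k. 1 \<le> k \<and> real (a k) \<le> x}"
proof (rule finite_imageD)
  have "a ` {k. 1 \<le> k \<and> real (a k) \<le> x} \<subseteq> {..nat \<lfloor>x\<rfloor>}"
    by (auto simp: le_nat_floor)
  then show "finite (a ` {k. 1 \<le> k \<and> real (a k) \<le> x})" by (rule finite_subset) simp
  have "inj_on a {1..}" using assms by (rule strict_mono_on_imp_inj_on)
  then show "inj_on a {k. 1 \<le> k \<and> real (a k) \<le> x}" by (rule inj_on_subset) auto
qed

lemma sum_card_fibre: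
  assumes "finite X" "finite V" "\<phi> ` X \<subseteq> V"
  shows "(\<Sum>v\<in>V. card {x\<in>X. \<phi> x = v}) = card X"
proof -
  have "card X = card (\<Union>v\<in>V. {x\<in>X. \<phi> x = v})" using assms(3) by (intro arg_cong[of _ _ card]) auto
  also have "\<dots> = (\<Sum>v\<in>V. card {x\<in>X. \<phi> x = v})"
    using assms by (intro card_UN_disjoint) auto
  finally show ?thesis by simp
qed

text \<open>A squared fibre size counts ordered pairs inside that fibre. Only an inequality holds,
  since \<open>V\<close> may miss some values.\<close>

lemma sum_card_fibre_square_le:
  assumes "finite X" "finite V"
  shows "(\<Sum>v\<in>V. (card {x\<in>X. \<phi> x = v})\<^sup>2) \<le> card {(x, y). x \<in> X \<and> y \<in> X \<and> \<phi> x = \<phi> y}"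
proof -
  define A where "A = (\<lambda>v. {x\<in>X. \<phi> x = v})"
  have "(\<Sum>v\<in>V. (card (A v))\<^sup>2) = (\<Sum>v\<in>V. card (A v \<times> A v))"
    by (simp add: card_cartesian_product power2_eq_square)
  also have "\<dots> = card (\<Union>v\<in>V. A v \<times> A v)"
    using assms by (intro card_UN_disjoint [symmetric]) (auto simp: A_def)
  also have "\<dots> \<le> card {(x, y). x \<in> X \<and> y \<in> X \<and> \<phi> x = \<phi> y}"
  proof (rule card_mono)
    show "finite {(x, y). x \<in> X \<and> y \<in> X \<and> \<phi> x = \<phi> y}"
      by (rule finite_subset[of _ "X \<times> X"]) (use assms in auto)
  qed (auto simp: A_def)
  finally show ?thesis by (simp add: A_def)
qed

text \<open>By injectivity of \<open>a\<close>, the index \<open>k\<close> determines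
  \<open>k'\<close>, and \<open>a k + (u - v) = a k'\<close> is again a term of the
  sequence.\<close>

lemma card_pairs_le_seq_count_shift:
  assumes a: "strict_mono_on {1..} (a :: nat \<Rightarrow> nat)" and z: "z \<le> x" and "v < u"
  shows "card {(k, k'). (1 \<le> k \<and> real (a k) \<le> z) \<and> (1 \<le> k' \<and> real (a k') \<le> z) \<and> a k + u = a k' + v}
    \<le> seq_count_shift a x (u - v)"
proof -
  define D where "D = {(k, k'). (1 \<le> k \<and> real (a k) \<le> z) \<and> (1 \<le> k' \<and> real (a k') \<le> z) \<and> a k + u = a k' + v}"
  have "inj_on a {1..}" using a by (rule strict_mono_on_imp_inj_on)
  then have "inj_on fst D" by (auto simp: inj_on_def D_def)
  then have "card D = card (fst ` D)" by (simp add: card_image)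
  also have "\<dots> \<le> card {n. 1 \<le> n \<and> real (a n) \<le> x \<and> a n + (u - v) \<in> a ` {1..}}"
  proof (rule card_mono)
    show "finite {n. 1 \<le> n \<and> real (a n) \<le> x \<and> a n + (u - v) \<in> a ` {1..}}"
      by (rule finite_subset[OF _ finite_seq_le[OF a, of x]]) auto
    show "fst ` D \<subseteq> {n. 1 \<le> n \<and> real (a n) \<le> x \<and> a n + (u - v) \<in> a ` {1..}}"
    proof
      fix k assume "k \<in> fst ` D"
      then obtain k' where k: "1 \<le> k" "real (a k) \<le> z" "1 \<le> k'" "a k + u = a k' + v"
        by (auto simp: D_def)
      then have "a k + (u - v) = a k'" using assms(3) by linarith
      then show "k \<in> {n. 1 \<le> n \<and> real (a n) \<le> x \<and> a n + (u - v) \<in> a ` {1..}}"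
        using k z by auto
    qed
  qed
  finally show ?thesis by (simp add: D_def seq_count_shift_def)
qed

text \<open>The coinciding pairs of representations are sorted by \<open>(p, q)\<close>. For
  \<open>p = q\<close> injectivity forces \<open>k = k'\<close>, which gives the first term; the
  cases \<open>q < p\<close> and \<open>p < q\<close> are symmetric, whence the factor 2.\<close>

lemma sum_square_representations_le:
  fixes a g :: "nat \<Rightarrow> nat"
  assumes a: "strict_mono_on {1..} a" and "z \<le> x" and "finite S" "finite V"
    and g: "strict_mono_on S g"
  defines "K \<equiv> {k. 1 \<le> k \<and> real (a k) \<le> z}"
  shows "(\<Sum>n\<in>V. (card {(k, p). k \<in> K \<and> p \<in> S \<and> a k + g p = n})\<^sup>2)
    \<le> card K * card S + 2 * (\<Sum>q\<in>S. \<Sum>p\<in>{p\<in>S. q < p}. seq_count_shift a x (g p - g q))"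
proof -
  define D where "D = (\<lambda>p q. {(k, k'). k \<in> K \<and> k' \<in> K \<and> a k + g p = a k' + g q})"
  define s where "s = (\<lambda>p q. seq_count_shift a x (g p - g q))"
  have finK: "finite K" unfolding K_def using a by (rule finite_seq_le)
  have finD: "finite (D p q)" for p q
    by (rule finite_subset[of _ "K \<times> K"]) (auto simp: D_def finK)
  have inj: "inj_on a {1..}" using a by (rule strict_mono_on_imp_inj_on)
  have lt: "card (D p q) \<le> s p q" if "p \<in> S" "q \<in> S" "q < p" for p q
  proof -
    have "g q < g p" using that g by (auto dest: strict_mono_onD)
    from card_pairs_le_seq_count_shift[OF a \<open>z \<le> x\<close> this] show ?thesis by (simp add: D_def K_def s_def)
  qed
  have swap: "card (D p q) = card (D q p)" for p q
  proof -
    have "D p q = prod.swap ` D q p" by (auto simp: D_def image_iff)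
    then show ?thesis by (simp add: card_image)
  qed
  have eq: "card (D p p) \<le> card K" for p
  proof -
    have "D p p \<subseteq> (\<lambda>k. (k, k)) ` K"
      using inj by (auto simp: D_def K_def inj_on_def)
    then have "card (D p p) \<le> card ((\<lambda>k. (k, k)) ` K)" using finK by (intro card_mono) auto
    also have "\<dots> \<le> card K" using finK by (rule card_image_le)
    finally show ?thesis .
  qed
  have "(\<Sum>n\<in>V. (card {(k, p). k \<in> K \<and> p \<in> S \<and> a k + g p = n})\<^sup>2)
      = (\<Sum>n\<in>V. (card {y\<in>K \<times> S. (\<lambda>(k, p). a k + g p) y = n})\<^sup>2)"
    by (intro sum.cong refl arg_cong[of _ _ "\<lambda>A. (card A)\<^sup>2"]) auto
  also have "\<dots> \<le> card {(y, y'). y \<in> K \<times> S \<and> y' \<in> K \<times> S \<and> (\<lambda>(k, p). a k + g p) y = (\<lambda>(k, p). a k + g p) y'}"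
    using finK assms by (intro sum_card_fibre_square_le) auto
  also have "\<dots> \<le> card ((\<lambda>((p, q), (k, k')). ((k, p), (k', q))) ` (SIGMA (p, q):S \<times> S. D p q))"
  proof (rule card_mono)
    show "finite ((\<lambda>((p, q), (k, k')). ((k, p), (k', q))) ` (SIGMA (p, q):S \<times> S. D p q))"
      by (rule finite_imageI) (use \<open>finite S\<close> finD in auto)
  qed (force simp: D_def image_iff)
  also have "\<dots> \<le> card (SIGMA (p, q):S \<times> S. D p q)"
    by (rule card_image_le) (use \<open>finite S\<close> finD in auto)
  also have "\<dots> = (\<Sum>(p, q)\<in>S \<times> S. card (D p q))"
    by (subst card_SigmaI) (use \<open>finite S\<close> finD in \<open>auto simp: split_def\<close>)
  also have "\<dots> = (\<Sum>p\<in>S. \<Sum>q\<in>S. card (D p q))" by (rule sum.cartesian_product [symmetric])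
  also have "\<dots> \<le> (\<Sum>p\<in>S. \<Sum>q\<in>S. (if p = q then card K else 0)
      + ((if q < p then s p q else 0) + (if p < q then s q p else 0)))"
  proof (intro sum_mono)
    fix p q assume pq: "p \<in> S" "q \<in> S"
    consider "p = q" | "p < q" | "q < p" by linarith
    then show "card (D p q) \<le> (if p = q then card K else 0)
      + ((if q < p then s p q else 0) + (if p < q then s q p else 0))"
    proof cases
      case 1
      then show ?thesis using eq by simp
    next
      case 2
      then show ?thesis using lt[of q p] pq swap[of p q] by simp
    next
      case 3
      then show ?thesis using lt[of p q] pq by simp
    qed
  qed
  also have "\<dots> = (\<Sum>p\<in>S. \<Sum>q\<in>S. if p = q then card K else 0)
      + ((\<Sum>p\<in>S. \<Sum>q\<in>S. if q < p then s p q else 0) + (\<Sum>p\<in>S. \<Sum>q\<in>S. if p < q then s q p else 0))"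
    by (simp only: sum.distrib)
  also have "(\<Sum>p\<in>S. \<Sum>q\<in>S. if q < p then s p q else 0) = (\<Sum>q\<in>S. \<Sum>p\<in>S. if q < p then s p q else 0)"
    by (rule sum.swap)
  also have "(\<Sum>p\<in>S. \<Sum>q\<in>S. if p = q then card K else 0) = card K * card S"
    using \<open>finite S\<close> by simp
  also have "(\<Sum>q\<in>S. \<Sum>p\<in>S. if q < p then s p q else 0) = (\<Sum>q\<in>S. \<Sum>p\<in>{p\<in>S. q < p}. s p q)"
    using \<open>finite S\<close> by (simp flip: sum.inter_filter)
  finally show ?thesis by (simp add: s_def mult_2)
qed

text \<open>A Paley-Zygmund argument: terms below \<open>T\<close> make up at most half of the sum,
  and Cauchy-Schwarz is applied to the remaining half.\<close>

lemma sum_square_le_card_large: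
  fixes u :: "'a \<Rightarrow> real" and T :: real
  assumes "finite V" "\<And>n. n \<in> V \<Longrightarrow> u n \<ge> 0" "2 * (T * card V) \<le> sum u V" "T \<ge> 0"
  shows "(sum u V)\<^sup>2 \<le> 4 * real (card {n\<in>V. T \<le> u n}) * (\<Sum>n\<in>V. (u n)\<^sup>2)"
proof -
  define G where "G = {n\<in>V. T \<le> u n}"
  have G: "G \<subseteq> V" "finite G" using assms by (auto simp: G_def)
  have "sum u V = sum u G + sum u (V - G)" using G assms(1) by (simp add: sum.subset_diff)
  also have "sum u (V - G) \<le> (\<Sum>n\<in>V - G. T)" by (intro sum_mono) (auto simp: G_def)
  also have "\<dots> = T * card (V - G)" by simp
  also have "\<dots> \<le> T * card V" using assms by (intro mult_left_mono) (auto intro!: card_mono)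
  finally have "sum u V \<le> 2 * sum u G" using assms(3) by linarith
  moreover have "sum u V \<ge> 0" using assms by (intro sum_nonneg)
  ultimately have "(sum u V)\<^sup>2 \<le> (2 * sum u G)\<^sup>2" by (intro power_mono)
  also have "\<dots> = 4 * (\<Sum>n\<in>G. 1 * u n)\<^sup>2" by (simp add: power_mult_distrib)
  also have "\<dots> \<le> 4 * ((\<Sum>n\<in>G. 1\<^sup>2) * (\<Sum>n\<in>G. (u n)\<^sup>2))"
    by (intro mult_left_mono Cauchy_Schwarz_ineq_sum) simp
  also have "\<dots> \<le> 4 * (card G * (\<Sum>n\<in>V. (u n)\<^sup>2))"
    using G assms by (intro mult_left_mono) (auto intro!: sum_mono2 mult_left_mono)
  finally show ?thesis by (simp add: G_def)
qed

section \<open>Growth of the polynomial and explicit lower bounds\<close>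

lemma poly_le_sum_abs_coeffs:
  fixes f :: "int poly" and x :: int
  assumes "x \<ge> 1"
  shows "poly f x \<le> (\<Sum>i\<le>degree f. \<bar>coeff f i\<bar>) * x ^ degree f"
proof -
  have "poly f x = (\<Sum>i\<le>degree f. coeff f i * x ^ i)" by (rule poly_altdef)
  also have "\<dots> \<le> (\<Sum>i\<le>degree f. \<bar>coeff f i\<bar> * x ^ degree f)"
    using assms by (intro sum_mono mult_mono power_increasing) auto
  finally show ?thesis by (simp add: sum_distrib_right)
qed

text \<open>Over the reals the derivative has positive leading coefficient, so it is eventually
  positive. Primes below \<open>P\<close> are discarded later, since \<open>f\<close> need not
  increase there.\<close>

lemma poly_eventually_strict_mono:
  fixes f :: "int poly"
  assumes "degree f \<ge> 1" "lead_coeff f > 0"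
  shows "\<exists>P::nat. \<forall>p q. P \<le> q \<longrightarrow> q < p \<longrightarrow> poly f (int q) < poly f (int p)"
proof -
  define F where "F = map_poly real_of_int f"
  have F: "poly F (of_int x) = of_int (poly f x)" for x
    unfolding F_def by (induction f) (auto simp: map_poly_pCons)
  have "degree F = degree f" by (simp add: F_def degree_map_poly)
  then have "lead_coeff (pderiv F) > 0"
    using assms by (simp add: degree_pderiv coeff_pderiv F_def coeff_map_poly)
  then obtain N where N: "\<And>x. x \<ge> N \<Longrightarrow> poly (pderiv F) x > 0"
    using poly_pinfty_gt_lc[of "pderiv F"] by (meson less_le_trans)
  have "poly f (int q) < poly f (int p)" if "nat \<lceil>N\<rceil> \<le> q" "q < p" for p q
  proof -
    have "N \<le> real q" using that by linarith
    have "poly F (real q) < poly F (real p)"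
    proof (rule DERIV_pos_imp_increasing[where f = "poly F"])
      fix x assume "real q \<le> x" "x \<le> real p"
      then have "poly (pderiv F) x > 0" using N \<open>N \<le> real q\<close> by simp
      then show "\<exists>y. (poly F has_real_derivative y) (at x) \<and> 0 < y"
        using poly_DERIV by blast
    qed (use that in simp)
    then show ?thesis using F[of "int q"] F[of "int p"] by simp
  qed
  then show ?thesis by blast
qed

text \<open>All sums \<open>a k + g p\<close> lie between 1 and \<open>x\<close>, so the first
  moment is exactly \<open>card K * card S\<close>. The second moment is split by \<open>q\<close>:
  \<open>E\<close> carries the shift hypothesis and \<open>D\<close> the sum of totient ratios. The
  last premise keeps \<open>T\<close> at most half the mean.\<close>

lemma square_le_card_large_representations:
  fixes a g :: "nat \<Rightarrow> nat" and D E T x z :: real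
  assumes a: "strict_mono_on {1..} a" "\<And>k. k \<ge> 1 \<Longrightarrow> a k \<ge> 1"
    and S: "finite S" "strict_mono_on S g" "\<And>p. p \<in> S \<Longrightarrow> real (g p) \<le> x - z"
    and x: "0 \<le> x" "z \<le> x"
    and shift: "\<And>r. r \<ge> 1 \<Longrightarrow> real (seq_count_shift a x r) \<le> E * (real r / real (totient r))"
    and D: "\<And>q. q \<in> S \<Longrightarrow> (\<Sum>p\<in>{p\<in>S. q < p}. real (g p - g q) / real (totient (g p - g q))) \<le> D"
    and "E \<ge> 0" "T \<ge> 0"
  defines "K \<equiv> {k. 1 \<le> k \<and> real (a k) \<le> z}"
  assumes T: "2 * (T * x) \<le> real (card K) * card S"
  shows "(real (card K) * card S)\<^sup>2
    \<le> 4 * real (card {n. 1 \<le> n \<and> real n \<le> x \<and> T \<le> real (card {(k, p). k \<in> K \<and> p \<in> S \<and> a k + g p = n})})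
        * (real (card K) * card S + 2 * (card S * (E * D)))"
proof -
  define V where "V = {1..nat \<lfloor>x\<rfloor>}"
  define u where "u = (\<lambda>n. card {(k, p). k \<in> K \<and> p \<in> S \<and> a k + g p = n})"
  have V: "n \<in> V \<longleftrightarrow> 1 \<le> n \<and> real n \<le> x" for n
    using x(1) by (auto simp: V_def le_nat_floor le_nat_iff le_floor_iff)
  have finK: "finite K" unfolding K_def using a(1) by (rule finite_seq_le)
  have "u = (\<lambda>n. card {y\<in>K \<times> S. (\<lambda>(k, p). a k + g p) y = n})"
    unfolding u_def by (intro ext arg_cong[of _ _ card]) auto
  moreover have "(\<lambda>(k, p). a k + g p) ` (K \<times> S) \<subseteq> V"
  proof safe
    fix k p assume "k \<in> K" "p \<in> S"
    then show "a k + g p \<in> V" using a(2)[of k] S(3)[of p] by (simp add: V K_def)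
  qed
  ultimately have "sum u V = card (K \<times> S)"
    using finK S(1) by (simp add: sum_card_fibre V_def)
  then have S1: "(\<Sum>n\<in>V. real (u n)) = real (card K) * card S"
    by (simp add: card_cartesian_product flip: of_nat_sum)
  have "real (\<Sum>n\<in>V. (u n)\<^sup>2)
      \<le> real (card K * card S + 2 * (\<Sum>q\<in>S. \<Sum>p\<in>{p\<in>S. q < p}. seq_count_shift a x (g p - g q)))"
    unfolding u_def K_def of_nat_le_iff
    by (rule sum_square_representations_le) (use a S x in \<open>auto simp: V_def\<close>)
  also have "\<dots> = real (card K) * card S
      + 2 * (\<Sum>q\<in>S. \<Sum>p\<in>{p\<in>S. q < p}. real (seq_count_shift a x (g p - g q)))"
    by simp
  also have "(\<Sum>q\<in>S. \<Sum>p\<in>{p\<in>S. q < p}. real (seq_count_shift a x (g p - g q)))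
      \<le> (\<Sum>q\<in>S. \<Sum>p\<in>{p\<in>S. q < p}. E * (real (g p - g q) / real (totient (g p - g q))))"
  proof (intro sum_mono shift)
    fix p q assume "q \<in> S" "p \<in> {p\<in>S. q < p}"
    then have "g q < g p" using S(2) by (auto dest: strict_mono_onD)
    then show "1 \<le> g p - g q" by simp
  qed
  also have "\<dots> \<le> (\<Sum>q\<in>S. E * D)"
    unfolding sum_distrib_left[symmetric] using D \<open>E \<ge> 0\<close> by (intro sum_mono mult_left_mono)
  also have "\<dots> = card S * (E * D)" by simp
  finally have S2: "(\<Sum>n\<in>V. (real (u n))\<^sup>2) \<le> real (card K) * card S + 2 * (card S * (E * D))"
    by simp
  have "real (card V) \<le> x" using x(1) by (simp add: V_def)
  then have "2 * (T * card V) \<le> 2 * (T * x)" using \<open>T \<ge> 0\<close> by (simp add: mult_left_mono)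
  with T have "2 * (T * card V) \<le> (\<Sum>n\<in>V. real (u n))" by (simp add: S1)
  then have "(\<Sum>n\<in>V. real (u n))\<^sup>2 \<le> 4 * real (card {n\<in>V. T \<le> real (u n)}) * (\<Sum>n\<in>V. (real (u n))\<^sup>2)"
    using \<open>T \<ge> 0\<close> by (intro sum_square_le_card_large) (auto simp: V_def)
  also have "\<dots> \<le> 4 * real (card {n\<in>V. T \<le> real (u n)}) * (real (card K) * card S + 2 * (card S * (E * D)))"
    using S2 by (intro mult_left_mono) auto
  finally have "(real (card K) * card S)\<^sup>2 \<le> 4 * real (card {n\<in>V. T \<le> real (u n)})
      * (real (card K) * card S + 2 * (card S * (E * D)))"
    by (simp only: S1)
  moreover have "{n\<in>V. T \<le> real (u n)} = {n. 1 \<le> n \<and> real n \<le> x \<and> T \<le> real (u n)}"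
    by (auto simp: V)
  ultimately show ?thesis by (simp only: u_def)
qed

text \<open>Allows \<open>m\<close> to be replaced by a lower bound although it occurs on both sides
  of the inequality.\<close>

lemma linear_bound_antimono:
  fixes A u v \<alpha> \<beta> :: real
  assumes "A * u \<le> \<alpha> + \<beta> * u" "0 \<le> v" "v \<le> u" "0 \<le> \<alpha>"
  shows "A * v \<le> \<alpha> + \<beta> * v"
proof (cases "A \<le> \<beta>")
  case True
  then have "A * v \<le> \<beta> * v" using assms(2) by (rule mult_right_mono)
  then show ?thesis using assms(4) by simp
next
  case False
  then have "(A - \<beta>) * v \<le> (A - \<beta>) * u" using assms(3) by (intro mult_left_mono) auto
  then show ?thesis using assms(1) by (simp add: algebra_simps)
qed

text \<open>
  The lower bound for \<open>G\<close> given by the first premise is increasing in \<open>N\<close>, \<open>s\<close> and \<open>m\<close>, so that no upper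
  bound on these quantities is needed.
\<close>

lemma card_large_lower_bound:
  fixes N s G e x m M \<kappa> E c c' :: real
  assumes le: "(N * s)\<^sup>2 \<le> 4 * G * (N * s + 2 * (s * (E * (x / e\<^sup>2) * (C * m))))"
    and N: "N \<ge> \<kappa> * x / e" and s: "s \<ge> c * m" and m: "m \<ge> c' * M"
    and pos: "\<kappa> > 0" "c > 0" "c' > 0" "M > 0" "x > 0" "e > 0" "E > 0" "C > 0" "G \<ge> 0"
  shows "G \<ge> \<kappa>\<^sup>2 * c * c' / (4 * (\<kappa> + 2 * E * C * c')) * x * (M / (M + e))"
proof -
  define N0 where "N0 = \<kappa> * x / e"
  define h where "h = 2 * E * C"
  define t where "t = h * m * (x / e\<^sup>2)"
  have N0: "N0 > 0" "N0 \<le> N" using pos N by (auto simp: N0_def)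
  have m0: "m > 0" using m pos by (smt (verit) mult_pos_pos)
  then have s0: "s > 0" using s pos by (smt (verit) mult_pos_pos)
  have h: "h > 0" using pos by (simp add: h_def)
  have t: "t > 0" using pos m0 h by (simp add: t_def)
  have "s * (N\<^sup>2 * s) \<le> s * (4 * G * (N + t))"
    using le by (simp add: t_def h_def power2_eq_square algebra_simps)
  then have 1: "N\<^sup>2 * s \<le> 4 * G * (N + t)" using s0 by simp
  \<comment> \<open>Multiplying by \<open>N0\<close>, using \<open>N0 <= N\<close> in the term with
    \<open>t\<close> and cancelling \<open>N\<close> replaces \<open>N\<close> by its lower
    bound.\<close>
  have "N * (N0 * (N * s)) = N0 * (N\<^sup>2 * s)" by (simp add: power2_eq_square)
  also have "\<dots> \<le> N0 * (4 * G * (N + t))" using 1 N0 by (intro mult_left_mono) auto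
  also have "\<dots> = 4 * G * (N * N0) + (4 * G * t) * N0" by (simp add: algebra_simps)
  also have "\<dots> \<le> 4 * G * (N * N0) + (4 * G * t) * N"
    using N0 pos t by (intro add_left_mono mult_left_mono) auto
  also have "\<dots> = N * (4 * G * (N0 + t))" by (simp add: algebra_simps)
  finally have "N0 * (N * s) \<le> 4 * G * (N0 + t)" using N0 by simp
  moreover have "N0 * (N0 * (c * m)) \<le> N0 * (N * s)"
    using N0 s pos m0 by (intro mult_left_mono mult_mono) auto
  ultimately have "N0 * (N0 * (c * m)) \<le> 4 * G * (N0 + t)" by simp
  then have "(N0 * (N0 * (c * m))) * (e\<^sup>2 / x) \<le> (4 * G * (N0 + t)) * (e\<^sup>2 / x)"
    using pos by (intro mult_right_mono) auto
  moreover have "(N0 * (N0 * (c * m))) * (e\<^sup>2 / x) = (\<kappa>\<^sup>2 * x * c) * m"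
    using pos by (simp add: N0_def power2_eq_square)
  moreover have "(4 * G * (N0 + t)) * (e\<^sup>2 / x) = 4 * G * \<kappa> * e + (4 * G * h) * m"
    using pos by (simp add: N0_def t_def power2_eq_square field_simps)
  ultimately have "(\<kappa>\<^sup>2 * x * c) * m \<le> 4 * G * \<kappa> * e + (4 * G * h) * m" by simp
  then have "(\<kappa>\<^sup>2 * x * c) * (c' * M) \<le> 4 * G * \<kappa> * e + (4 * G * h) * (c' * M)"
    by (rule linear_bound_antimono) (use m pos in auto)
  also have "\<dots> \<le> 4 * G * ((\<kappa> + h * c') * (M + e))"
    using pos h by (simp add: algebra_simps)
  finally have "\<kappa>\<^sup>2 * x * c * c' * M \<le> G * ((4 * (\<kappa> + h * c')) * (M + e))"
    by (simp add: mult_ac)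
  moreover have "(4 * (\<kappa> + h * c')) * (M + e) > 0" using pos h by (simp add: add_pos_pos)
  ultimately have "\<kappa>\<^sup>2 * x * c * c' * M / ((4 * (\<kappa> + h * c')) * (M + e)) \<le> G"
    by (simp only: pos_divide_le_eq)
  then show ?thesis by (simp add: h_def mult_ac)
qed

text \<open>\<open>Y\<close> is the integer part of \<open>(x / (2 * B)) powr (1 / d)\<close>, the
  largest value allowed by the first condition.\<close>

lemma exists_prime_range:
  fixes B :: real and d P :: nat
  assumes d: "d \<ge> 1" and B: "B \<ge> 1"
  shows "\<exists>c'>0. \<exists>x0\<ge>2. \<forall>x\<ge>x0. \<exists>Y\<ge>2. B * real Y ^ d \<le> x / 2 \<and>
    c' * (x powr (1 / d) / ln x) \<le> Y / ln Y \<and>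
    1 / 12 * (Y / ln Y) \<le> real (card {p\<in>primes_le Y. P \<le> p})"
proof -
  \<comment> \<open>The final halving pays for rounding, through \<open>y / 2 <= Y\<close>.\<close>
  define c' where "c' = (1 / (2 * B)) powr (1 / d) / 2"
  \<comment> \<open>Since \<open>576 = 24^2\<close>, this forces \<open>24 * P <= sqrt Y\<close> and
    hence \<open>P * ln Y <= Y / 12\<close>: dropping the primes below \<open>P\<close> costs at
    most half of the Chebyshev bound \<open>Y / 6\<close>.\<close>
  define Y0 where "Y0 = 2 + 576 * P\<^sup>2"
  define x0 where "x0 = 2 * B * real (Y0 + 1) ^ d"
  have "c' > 0" using B by (simp add: c'_def)
  moreover have "x0 \<ge> 2"
  proof -
    have "1 * 1 \<le> B * real (Y0 + 1) ^ d" using B by (intro mult_mono one_le_power) auto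
    then show ?thesis by (simp add: x0_def)
  qed
  moreover have "\<exists>Y\<ge>2. B * real Y ^ d \<le> x / 2 \<and> c' * (x powr (1 / d) / ln x) \<le> Y / ln Y \<and>
    1 / 12 * (Y / ln Y) \<le> real (card {p\<in>primes_le Y. P \<le> p})" if x: "x \<ge> x0" for x
  proof -
    define y where "y = (x / (2 * B)) powr (1 / d)"
    define Y where "Y = nat \<lfloor>y\<rfloor>"
    have x2: "x \<ge> 2" using x \<open>x0 \<ge> 2\<close> by simp
    have "real (Y0 + 1) = (real (Y0 + 1) ^ d) powr (1 / d)"
      using d by (simp add: powr_powr flip: powr_realpow)
    also have "\<dots> \<le> y"
      unfolding y_def using x B by (intro powr_mono2) (auto simp: x0_def field_simps)
    finally have yY0: "real Y0 + 1 \<le> y" by simp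
    have "real Y0 \<ge> 2" by (simp add: Y0_def)
    with yY0 have y2: "y \<ge> 3" by linarith
    have Yy: "real Y \<le> y" unfolding Y_def using y2 by (intro of_nat_floor) auto
    have "y < real Y + 1" unfolding Y_def using y2 by linarith
    then have YY0: "Y \<ge> Y0" and yY: "y / 2 \<le> real Y" using yY0 y2 by linarith+
    have Y2: "Y \<ge> 2" using YY0 by (simp add: Y0_def)
    have lnY: "ln (real Y) > 0" using Y2 by simp
    have "real Y ^ d \<le> y ^ d" using Yy by (intro power_mono) auto
    also have "y ^ d = x / (2 * B)"
      using d B x2 y2 by (simp add: y_def powr_powr flip: powr_realpow)
    finally have Yd: "real Y ^ d \<le> x / (2 * B)" .
    have 1: "B * real Y ^ d \<le> x / 2"
      using mult_left_mono[OF Yd, of B] B by simp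
    have "real Y \<le> real Y ^ d" using d Y2 by (intro self_le_power) auto
    moreover have "1 * real Y ^ d \<le> B * real Y ^ d" using B by (intro mult_right_mono) auto
    ultimately have "real Y \<le> x" using 1 x2 by linarith
    then have lnYx: "ln (real Y) \<le> ln x" using Y2 x2 by simp
    have "c' * (x powr (1 / d) / ln x) = (y / 2) / ln x"
      using x2 B by (simp add: c'_def y_def powr_divide)
    also have "\<dots> \<le> real Y / ln Y"
      using yY lnY lnYx y2 by (intro frac_le) auto
    finally have 2: "c' * (x powr (1 / d) / ln x) \<le> Y / ln Y" .
    have "primes_le Y \<subseteq> {p\<in>primes_le Y. P \<le> p} \<union> {..<P}" by auto
    then have "card (primes_le Y) \<le> card ({p\<in>primes_le Y. P \<le> p} \<union> {..<P})"
      by (intro card_mono) auto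
    also have "\<dots> \<le> card {p\<in>primes_le Y. P \<le> p} + card {..<P}" by (rule card_Un_le)
    finally have "real (card (primes_le Y)) * ln Y \<le> (real (card {p\<in>primes_le Y. P \<le> p}) + real P) * ln Y"
      using lnY by (intro mult_right_mono) auto
    moreover have "real Y / 6 \<le> real (card (primes_le Y)) * ln Y"
    proof -
      have "real Y * (1 / 2) \<le> real Y * ln 2"
        using ln_le_minus_one[of "1 / 2"] by (intro mult_left_mono) (auto simp: ln_div)
      then show ?thesis using card_primes_le_lower[OF Y2] by linarith
    qed
    moreover have "real P * ln Y \<le> real Y / 12"
    proof -
      have "(24 * real P)\<^sup>2 \<le> real Y"
      proof -
        have "576 * P\<^sup>2 \<le> Y" using YY0 by (simp add: Y0_def)
        then have "real (576 * P\<^sup>2) \<le> real Y" by (simp only: of_nat_le_iff)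
        then show ?thesis by (simp add: power_mult_distrib)
      qed
      then have P: "24 * real P \<le> sqrt Y" by (rule real_le_rsqrt)
      have "24 * (real P * ln Y) \<le> (24 * real P) * (2 * sqrt Y)"
        using ln_le_twice_sqrt[of Y] Y2 mult_left_mono[of "ln Y" "2 * sqrt Y" "24 * real P"] by simp
      also have "\<dots> \<le> sqrt Y * (2 * sqrt Y)" using P by (intro mult_right_mono) auto
      also have "\<dots> = 2 * real Y" by simp
      finally show ?thesis by simp
    qed
    ultimately have "real Y / 12 \<le> real (card {p\<in>primes_le Y. P \<le> p}) * ln Y"
      by (simp add: distrib_right)
    then have "1 / 12 * (Y / ln Y) \<le> real (card {p\<in>primes_le Y. P \<le> p})"
      using lnY by (simp add: field_simps)
    with 1 2 Y2 show ?thesis by blast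
  qed
  ultimately show ?thesis by blast
qed

lemma poly_ge_linear:
  fixes f :: "int poly"
  assumes "\<And>p q. P \<le> q \<Longrightarrow> q < p \<Longrightarrow> poly f (int q) < poly f (int p)"
  shows "poly f (int P) + int j \<le> poly f (int (P + j))"
proof (induction j)
  case (Suc j)
  have "poly f (int (P + j)) < poly f (int (P + Suc j))" by (rule assms) auto
  with Suc show ?case by simp
qed simp

text \<open>\<open>card\<close> is 0 on infinite sets, so finiteness must be known before
  \<open>rep_count\<close> can be bounded below by a count over a subset. Beyond \<open>P\<close>
  the integer values of \<open>f\<close> grow by at least 1 per step, which bounds
  \<open>p\<close>.\<close>

lemma finite_representations:
  fixes a :: "nat \<Rightarrow> nat"
  assumes a: "strict_mono_on {1..} a" and pos: "\<And>n::nat. n \<ge> 1 \<Longrightarrow> poly f (int n) \<ge> 1"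
    and f: "\<And>p q. P \<le> q \<Longrightarrow> q < p \<Longrightarrow> poly f (int q) < poly f (int p)"
  shows "finite {(k, p). 1 \<le> k \<and> prime p \<and> int (a k) + poly f (int p) = int n}"
proof (rule finite_subset)
  show "{(k, p). 1 \<le> k \<and> prime p \<and> int (a k) + poly f (int p) = int n}
    \<subseteq> {k. 1 \<le> k \<and> real (a k) \<le> real n} \<times> {..P + nat (int n - poly f (int P))}"
  proof safe
    fix k p assume *: "1 \<le> k" "prime p" "int (a k) + poly f (int p) = int n"
    then have "poly f (int p) \<ge> 1" by (intro pos) (auto simp: prime_ge_Suc_0_nat)
    with * show "real (a k) \<le> real n" by simp
    show "p \<le> P + nat (int n - poly f (int P))"
      using poly_ge_linear[OF f, of P "p - P"] * by (cases "p \<ge> P") auto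
  qed
  show "finite ({k. 1 \<le> k \<and> real (a k) \<le> real n} \<times> {..P + nat (int n - poly f (int P))})"
    by (intro finite_cartesian_product finite_seq_le[OF a]) auto
qed

section \<open>Choice of constants and conclusion\<close>

theorem theorem1p4:
  fixes f :: "int poly" and K1 K2 K3 K4 :: real
  assumes "degree f \<ge> 1" and "lead_coeff f > 0"
    and "\<forall>n::nat. n \<ge> 1 \<longrightarrow> poly f (int n) \<ge> 1"
    and "K1 > 0" and "K2 > 0" and "K3 > 0" and "K4 > 0"
  shows "\<exists>x0 c1 c2 :: real. x0 > 0 \<and> c1 > 0 \<and> c2 > 0 \<and>
    (\<forall>(\<eta> :: real \<Rightarrow> real) (a :: nat \<Rightarrow> nat).
      (\<forall>x\<ge>2. \<eta> x > 0) \<longrightarrow>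
      strict_mono_on {1..} a \<longrightarrow>
      (\<forall>n\<ge>1. a n \<ge> 1) \<longrightarrow>
      (\<forall>x\<ge>2. K1 * x / \<eta> x \<le> real (seq_count a x) \<and>
              real (seq_count a x) \<le> K2 * x / \<eta> x) \<longrightarrow>
      (\<forall>x\<ge>2. real (seq_count a (x / 2)) \<ge> K3 * real (seq_count a x)) \<longrightarrow>
      (\<forall>x\<ge>2. \<forall>r::nat. r \<ge> 1 \<longrightarrow>
         real (seq_count_shift a x r)
           \<le> K4 * (real r / real (totient r)) * (x / (\<eta> x)\<^sup>2)) \<longrightarrow>
      (\<forall>x\<ge>x0.
         real (card {n::nat. 1 \<le> n \<and> real n \<le> x \<and>
           real (rep_count a f n) \<ge> c1 * (x powr (1 / real (degree f)) / (\<eta> x * ln x))})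
         \<ge> c2 * x * (x powr (1 / real (degree f)) /
                (x powr (1 / real (degree f)) + \<eta> x * ln x))))"
proof -
  define d where "d = degree f"
  define B where "B = (\<Sum>i\<le>d. \<bar>coeff f i\<bar>)"
  \<comment> \<open>Nothing is truncated at primes, because \<open>f\<close> is positive
    there.\<close>
  define g where "g = (\<lambda>p. nat (poly f (int p)))"
  have fpos: "poly f (int n) \<ge> 1" if "n \<ge> 1" for n using assms(3) that by simp
  have "\<bar>coeff f d\<bar> \<le> B" unfolding B_def by (rule member_le_sum) auto
  then have B: "real_of_int B \<ge> 1" using assms(2) by (simp add: d_def)
  have polyB: "real_of_int (poly f (int p)) \<le> B * real Y ^ d" if "1 \<le> p" "p \<le> Y" for p Y
  proof -
    have "real_of_int (poly f (int p)) \<le> real_of_int (B * int p ^ d)"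
      using poly_le_sum_abs_coeffs[of "int p" f] that by (simp only: of_int_le_iff B_def d_def)
    also have "\<dots> = B * real p ^ d" by simp
    also have "\<dots> \<le> B * real Y ^ d" using that B by (intro mult_left_mono power_mono) auto
    finally show ?thesis .
  qed
  obtain P :: nat where P: "\<And>p q. P \<le> q \<Longrightarrow> q < p \<Longrightarrow> poly f (int q) < poly f (int p)"
    using poly_eventually_strict_mono[OF assms(1,2)] by blast
  obtain C where C0: "C > 0" and "\<forall>Y\<ge>2. \<forall>c S. S \<subseteq> primes_le Y \<longrightarrow>
    (\<forall>p\<in>S. 1 \<le> poly f (int p) - c \<and> real_of_int (poly f (int p) - c) \<le> B * real Y ^ d) \<longrightarrow>
    (\<Sum>p\<in>S. real (nat (poly f (int p) - c)) / real (totient (nat (poly f (int p) - c)))) * ln Y \<le> C * Y"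
    using sum_totient_ratio_poly_le[OF assms(1,2) B, folded d_def] by (elim exE conjE) (rule that)
  then have C: "(\<Sum>p\<in>S. real (nat (poly f (int p) - c)) / real (totient (nat (poly f (int p) - c)))) * ln Y \<le> C * Y"
    if "Y \<ge> 2" "S \<subseteq> primes_le Y"
      "\<forall>p\<in>S. 1 \<le> poly f (int p) - c \<and> real_of_int (poly f (int p) - c) \<le> B * real Y ^ d" for Y c S
    using that by simp
  obtain c' x0 where c': "c' > 0" and x0: "x0 \<ge> 2"
    and range: "\<forall>x\<ge>x0. \<exists>Y\<ge>2. B * real Y ^ d \<le> x / 2 \<and>
      c' * (x powr (1 / d) / ln x) \<le> Y / ln Y \<and>
      1 / 12 * (Y / ln Y) \<le> real (card {p\<in>primes_le Y. P \<le> p})"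
    using exists_prime_range[OF assms(1) B, of P, folded d_def] by (elim exE conjE) (rule that)
  \<comment> \<open>The number of terms up to \<open>x / 2\<close> is at least
    \<open>K3 * K1 * x / \<eta> x\<close>.\<close>
  define \<kappa> where "\<kappa> = K1 * K3"
  \<comment> \<open>The factors come from the lower bounds for \<open>card K\<close> and
    \<open>card S\<close>; the 2 puts the threshold at half of the guaranteed mean.\<close>
  define c1 where "c1 = \<kappa> * (1 / 12) * c' / 2"
  \<comment> \<open>The constant of \<open>card_large_lower_bound\<close> with
    \<open>c = 1 / 12\<close> and \<open>E = K4\<close>.\<close>
  define c2 where "c2 = \<kappa>\<^sup>2 * (1 / 12) * c' / (4 * (\<kappa> + 2 * K4 * C * c'))"
  have \<kappa>: "\<kappa> > 0" using assms by (simp add: \<kappa>_def)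
  have c12: "c1 > 0" "c2 > 0" using \<kappa> c' C0 assms by (auto simp: c1_def c2_def intro!: divide_pos_pos add_pos_pos)
  have main: "real (card {n::nat. 1 \<le> n \<and> real n \<le> x \<and>
           real (rep_count a f n) \<ge> c1 * (x powr (1 / real d) / (\<eta> x * ln x))})
         \<ge> c2 * x * (x powr (1 / real d) / (x powr (1 / real d) + \<eta> x * ln x))"
    if \<eta>: "\<forall>x\<ge>2. \<eta> x > 0" and a: "strict_mono_on {1..} a" "\<forall>n\<ge>1. a n \<ge> 1"
      and K1: "\<forall>x\<ge>2. K1 * x / \<eta> x \<le> real (seq_count a x) \<and> real (seq_count a x) \<le> K2 * x / \<eta> x"
      and K3: "\<forall>x\<ge>2. real (seq_count a (x / 2)) \<ge> K3 * real (seq_count a x)"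
      and K4: "\<forall>x\<ge>2. \<forall>r::nat. r \<ge> 1 \<longrightarrow>
         real (seq_count_shift a x r) \<le> K4 * (real r / real (totient r)) * (x / (\<eta> x)\<^sup>2)"
      and x: "x \<ge> x0"
    for \<eta> :: "real \<Rightarrow> real" and a :: "nat \<Rightarrow> nat" and x :: real
  proof -
    obtain Y where Y: "Y \<ge> 2" "B * real Y ^ d \<le> x / 2"
      "c' * (x powr (1 / d) / ln x) \<le> Y / ln Y"
      "1 / 12 * (Y / ln Y) \<le> real (card {p\<in>primes_le Y. P \<le> p})"
      using range x by blast
    \<comment> \<open>With the logarithm inside \<open>M\<close>, the ratio
      \<open>M / (M + \<eta> x)\<close> becomes the claimed one after expanding by
      \<open>ln x\<close>.\<close>
    define M where "M = x powr (1 / d) / ln x"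
    define S where "S = {p\<in>primes_le Y. P \<le> p}"
    define K where "K = {k. 1 \<le> k \<and> real (a k) \<le> x / 2}"
    define T where "T = c1 * (M / \<eta> x)"
    define u where "u = (\<lambda>n. card {(k, p). k \<in> K \<and> p \<in> S \<and> a k + g p = n})"
    have x2: "x \<ge> 2" using x x0 by simp
    have e: "\<eta> x > 0" using \<eta> x2 by simp
    have lnx: "ln x > 0" using x2 by simp
    have lnY: "ln (real Y) > 0" using Y by simp
    have M: "M > 0" using x2 by (simp add: M_def)
    have T0: "T \<ge> 0" using c12 M e by (simp add: T_def)
    have p1: "p \<ge> 1" "p \<le> Y" "prime p" "P \<le> p" if "p \<in> S" for p
      using that by (auto simp: S_def primes_le_def prime_ge_Suc_0_nat)
    have g: "strict_mono_on S g"
    proof (rule strict_mono_onI)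
      fix q p assume "q \<in> S" "p \<in> S" "q < p"
      then show "g q < g p" using P[of q p] p1[of q] fpos[of q] by (simp add: g_def)
    qed
    have gx: "real (g p) \<le> x - x / 2" if "p \<in> S" for p
    proof -
      have "real (g p) = real_of_int (poly f (int p))" using fpos[of p] p1[OF that] by (simp add: g_def)
      also have "\<dots> \<le> B * real Y ^ d" using p1[OF that] by (intro polyB) auto
      finally show ?thesis using Y(2) by simp
    qed
    \<comment> \<open>The averaged bound with shift \<open>c = f q\<close>; monotonicity beyond
      \<open>P\<close> makes the differences at least 1.\<close>
    have D: "(\<Sum>p\<in>{p\<in>S. q < p}. real (g p - g q) / real (totient (g p - g q))) \<le> C * (Y / ln Y)"
      if q: "q \<in> S" for q
    proof -
      have "g p - g q = nat (poly f (int p) - poly f (int q))" for p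
        using fpos[of q] p1(1)[OF q] unfolding g_def by linarith
      then have "(\<Sum>p\<in>{p\<in>S. q < p}. real (g p - g q) / real (totient (g p - g q)))
        = (\<Sum>p\<in>{p\<in>S. q < p}. real (nat (poly f (int p) - poly f (int q)))
            / real (totient (nat (poly f (int p) - poly f (int q)))))"
        by (simp only:)
      moreover have "\<dots> * ln Y \<le> C * Y"
      proof (rule C)
        show "\<forall>p\<in>{p\<in>S. q < p}. 1 \<le> poly f (int p) - poly f (int q) \<and>
          real_of_int (poly f (int p) - poly f (int q)) \<le> B * real Y ^ d"
        proof (intro ballI conjI)
          fix p assume p: "p \<in> {p\<in>S. q < p}"
          then show "1 \<le> poly f (int p) - poly f (int q)" using P[of q p] p1(4)[OF q] by simp
          have "real_of_int (poly f (int p) - poly f (int q)) \<le> real_of_int (poly f (int p))"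
            using fpos[of q] p1(1)[OF q] by simp
          also have "\<dots> \<le> B * real Y ^ d" using p1[of p] p by (intro polyB) auto
          finally show "real_of_int (poly f (int p) - poly f (int q)) \<le> B * real Y ^ d" .
        qed
      qed (use Y S_def in auto)
      ultimately show ?thesis using lnY by (simp add: pos_le_divide_eq)
    qed
    have N: "\<kappa> * x / \<eta> x \<le> real (card K)"
    proof -
      have "K3 * (K1 * x / \<eta> x) \<le> K3 * real (seq_count a x)"
        using K1 x2 assms by (intro mult_left_mono) auto
      also have "\<dots> \<le> real (seq_count a (x / 2))" using K3 x2 by simp
      finally show ?thesis by (simp add: K_def seq_count_def \<kappa>_def mult_ac)
    qed
    have s: "1 / 12 * (Y / ln Y) \<le> real (card S)" using Y(4) by (simp add: S_def)
    have m: "c' * M \<le> Y / ln Y" using Y(3) by (simp add: M_def)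
    have T: "2 * (T * x) \<le> real (card K) * card S"
    proof -
      have "2 * (T * x) = (\<kappa> * x / \<eta> x) * (1 / 12 * (c' * M))" by (simp add: T_def c1_def mult_ac)
      also have "\<dots> \<le> real (card K) * card S"
        using N s m \<kappa> x2 e c' M by (intro mult_mono) auto
      finally show ?thesis .
    qed
    \<comment> \<open>The moment inequality with \<open>E = K4 * (x / (\<eta> x)^2)\<close> and
      \<open>D = C * (Y / ln Y)\<close>.\<close>
    have "(real (card K) * card S)\<^sup>2 \<le> 4 * real (card {n. 1 \<le> n \<and> real n \<le> x \<and> T \<le> real (u n)})
        * (real (card K) * card S + 2 * (card S * (K4 * (x / (\<eta> x)\<^sup>2) * (C * (Y / ln Y)))))"
      unfolding u_def K_def
    proof (rule square_le_card_large_representations[where z = "x / 2"])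
      show "real (seq_count_shift a x r) \<le> K4 * (x / (\<eta> x)\<^sup>2) * (real r / real (totient r))" if "r \<ge> 1" for r
      proof -
        have "K4 * (x / (\<eta> x)\<^sup>2) * (real r / real (totient r)) = K4 * (real r / real (totient r)) * (x / (\<eta> x)\<^sup>2)"
          by (simp only: mult_ac)
        then show ?thesis using K4 x2 that by presburger
      qed
      show "2 * (T * x) \<le> real (card {k. 1 \<le> k \<and> real (a k) \<le> x / 2}) * real (card S)"
        using T by (simp add: K_def)
    qed (use a g gx x2 D T0 assms in \<open>auto simp: S_def\<close>)
    then have "c2 * x * (M / (M + \<eta> x)) \<le> real (card {n. 1 \<le> n \<and> real n \<le> x \<and> T \<le> real (u n)})"
      unfolding c2_def
      by (rule card_large_lower_bound) (use N s m \<kappa> c' M x2 e assms C0 in auto)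
    also have "\<dots> \<le> real (card {n. 1 \<le> n \<and> real n \<le> x \<and> T \<le> real (rep_count a f n)})"
    proof (intro of_nat_mono card_mono)
      show "finite {n. 1 \<le> n \<and> real n \<le> x \<and> T \<le> real (rep_count a f n)}"
        by (rule finite_subset[of _ "{..nat \<lfloor>x\<rfloor>}"]) (auto simp: le_nat_floor)
      have "u n \<le> rep_count a f n" for n
        unfolding u_def rep_count_def
      proof (rule card_mono)
        show "finite {(k, p). 1 \<le> k \<and> prime p \<and> int (a k) + poly f (int p) = int n}"
          using a(1) fpos P by (rule finite_representations)
        show "{(k, p). k \<in> K \<and> p \<in> S \<and> a k + g p = n}
            \<subseteq> {(k, p). 1 \<le> k \<and> prime p \<and> int (a k) + poly f (int p) = int n}"
        proof safe
          fix k p assume "k \<in> K" "p \<in> S"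
          then show "1 \<le> k" "prime p" "int (a k) + poly f (int p) = int (a k + g p)"
            using p1[of p] fpos[of p] by (auto simp: K_def g_def)
        qed
      qed
      then show "{n. 1 \<le> n \<and> real n \<le> x \<and> T \<le> real (u n)}
          \<subseteq> {n. 1 \<le> n \<and> real n \<le> x \<and> T \<le> real (rep_count a f n)}"
        by (auto intro: order_trans)
    qed
    also have "T = c1 * (x powr (1 / real d) / (\<eta> x * ln x))"
      by (simp add: T_def M_def mult_ac)
    also have "M / (M + \<eta> x) = x powr (1 / real d) / (x powr (1 / real d) + \<eta> x * ln x)"
      using lnx by (simp add: M_def field_simps)
    finally show ?thesis .
  qed
  show ?thesis
    using x0 c12 main unfolding d_def
    by (intro exI[of _ x0] exI[of _ c1] exI[of _ c2] conjI allI impI) auto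
qed

end
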